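(* Assume that $F(x)$ and $F'(x)=\frac{\partial}{\partial x}F(x,\underline a)$ have no common factors, i.e. $F'(x_i)\neq 0$ for $i=1,\dots,\mu$. Then $$dv=\sum_{i=1}^{\mu} f(x_i,y_i)\,dx_i=\sum_{j=1}^{\alpha}\mathrm{res}_{\beta_j}(S(x))-\varPi(S(x)),$$ where $\beta_1,\dots,\beta_\alpha\in\overline K$ are the (distinct) roots of $f_2(x)F_0(x)$.
   Context: Let $K\subseteq\mathbb{C}$ be a computable field (its elements have explicit representations in which the field operations can be done algorithmically), with algebraic closure $\overline K$. Let $\chi(y)=\chi(x,y)\in K[x,y]$ be monic of degree $n$ in $y$ and irreducible over $\mathbb{C}$; put $\chi'(y)=\frac{\partial\chi}{\partial y}(x,y)$ and let $y^{(1)},\dots,y^{(n)}$ be the roots of $\chi(x,y)$ viewed as a polynomial in $y$ over $K(x)$, in a splitting field. Let $\theta(y)=\theta(x,y,\underline a)=\sum_{j=0}^{n-1}q_j(x)y^j\neq 0$, where the $q_j$ are polynomials in $x$, some of whose coefficients are parameters $\underline a=a_1,a_2,\dots$ (finitely many), the other coefficients lying in $K$. A subset of the $a_i$ is algebraically independent over $K(x)$, and each remaining $a_i$ is a linear combination, with coefficients in $K$, of $1$ and the independent ones (so $K[\underline a]$ is a polynomial ring in the independent ones). $\delta$ is the differential with respect to $\underline a$ with $x$ and the $y^{(\ell)}$ held constant: $\delta h=\sum_i\frac{\partial h}{\partial a_i}da_i$; derivations $\partial/\partial a_i$ are extended uniquely to algebraic extensions. Let $r(x)=\prod_{\ell=1}^n\theta(x,y^{(\ell)},\underline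 a)\in K[x,\underline a]$ (the resultant of $\chi,\theta$ with respect to $y$). Factor $r(x)=F_0(x)F(x)$ with $F_0(x)\in K[x]$, $F(x)=F(x,\underline a)\in K[x,\underline a]$, where, as polynomials in $x$, all roots of $F_0$ are algebraic over $K$ and no root of $F$ is algebraic over $K$ ($K$ being replaced by a finite extension if needed). Let $(x_1,y_1),\dots,(x_\mu,y_\mu)$ be the solutions, in an algebraic closure of $K(\underline a)$, of $\chi(x,y)=\theta(x,y,\underline a)=0$ with $x_i$ transcendental over $K$ (equivalently $dx_i\ne0$); the $x_i$ are the roots of $F(x)$, and $dx_i=\sum_k\frac{\partial x_i}{\partial a_k}da_k$. Let $f(x,y)$ be a rational function over $K$, represented modulo $\chi$ as $f(x,y)=\dfrac{f_1(x,y)}{f_2(x)\chi'(y)}$ with $f_1\in K[x,y]$ and $0\neq f_2\in K[x]$. Put $$S(x)=\sum_{\ell=1}^n f(x,y^{(\ell)})\frac{\delta\theta(y^{(\ell)})}{\theta(y^{(\ell)})},$$ which is a differential form in the $da_i$ with coefficients rational functions of $x$ and $\underline a$. For a rational function $g(x)$, $\mathrm{res}_\beta(g(x))$ is the coefficient of $\frac1{x-\beta}$ in its Laurent expansion at $x=\beta$, and $\varPi(g(x))$ is the coefficient of $\frac1x$ in its expansion in descending powers of $x$ at $x=\infty$. These operators are applied to $S(x)$ by treating the $da_i$ as variables (i.e. coefficientwise). *)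

theory Defs
  imports
    "HOL-Algebra.Algebraic_Closure_Type"
    "HOL-Library.Poly_Mapping"
begin

hide_const (open) Divisibility.irreducible Polynomials.degree Poly_Mapping.degree

section \<open>Computable subfields of the complex numbers\<close>

text \<open>
  \<open>recursive_fun k f\<close>: the restriction of \<open>f\<close> to lists of length \<open>k\<close> is a total recursive function
  of \<open>k\<close> arguments (basic functions, composition, primitive recursion, and minimisation of
  functions for which a zero always exists). Values on lists of other lengths are irrelevant.
\<close>

inductive recursive_fun :: "nat \<Rightarrow> (nat list \<Rightarrow> nat) \<Rightarrow> bool" where
  zero: "recursive_fun k (\<lambda>_. 0)"
| succ: "recursive_fun 1 (\<lambda>ns. Suc (ns ! 0))"
| proj: "i < k \<Longrightarrow> recursive_fun k (\<lambda>ns. ns ! i)"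
| comp: "recursive_fun (length hs) g \<Longrightarrow> (\<And>h. h \<in> set hs \<Longrightarrow> recursive_fun k h) \<Longrightarrow>
    recursive_fun k (\<lambda>ns. g (map (\<lambda>h. h ns) hs))"
| prec: "recursive_fun k g \<Longrightarrow> recursive_fun (Suc (Suc k)) h \<Longrightarrow>
    recursive_fun (Suc k) (\<lambda>ns. rec_nat (g (tl ns)) (\<lambda>m r. h (m # r # tl ns)) (hd ns))"
| mu: "recursive_fun (Suc k) g \<Longrightarrow> (\<And>ns. length ns = k \<Longrightarrow> \<exists>m. g (m # ns) = 0) \<Longrightarrow>
    recursive_fun k (\<lambda>ns. LEAST m. g (m # ns) = 0)"
| ext: "recursive_fun k f \<Longrightarrow> (\<And>ns. length ns = k \<Longrightarrow> f ns = g ns) \<Longrightarrow> recursive_fun k g"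

text \<open>
  The elements of \<open>K\<close> are represented by natural numbers in such a way that the operations are
  recursive on representations. As \<open>K\<close> is infinite, a representation with a decidable set of codes
  and decidable equality can be taken to be a bijection from the natural numbers; subtraction and
  inversion are then recursive by search.
\<close>

definition computable_subfield :: "complex set \<Rightarrow> bool" where
  "computable_subfield K \<longleftrightarrow> subfield K (ring_of_type_algebra :: complex ring) \<and>
    (\<exists>e. bij_betw e (UNIV :: nat set) K \<and>
      (\<exists>pl. recursive_fun 2 pl \<and> (\<forall>m n. e (pl [m, n]) = e m + e n)) \<and>
      (\<exists>ti. recursive_fun 2 ti \<and> (\<forall>m n. e (ti [m, n]) = e m * e n)))"


section \<open>The ambient rings and fields\<close>

text \<open>
  The independent parameters are modelled by the variables of a polynomial ring, indexed by natural
  numbers. Coefficients are complex; that they lie in the given field \<open>K\<close> is always stated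
  explicitly.
    \<^item> \<open>param_poly\<close> is \<open>\<complex>[a]\<close>;
    \<^item> \<open>param_alg\<close> is an algebraic closure of \<open>\<complex>(a)\<close>, hence contains one of \<open>K(a)\<close>;
    \<^item> \<open>ratfun\<close> is the field of rational functions in \<open>x\<close> over \<open>param_alg\<close>;
    \<^item> \<open>algfun\<close> is an algebraic closure of \<open>ratfun\<close>, so it contains a splitting field of \<open>\<chi>\<close> over
      \<open>K(x)\<close> together with the parameters.
\<close>

type_synonym param_poly = "(nat \<Rightarrow>\<^sub>0 nat) \<Rightarrow>\<^sub>0 complex"
type_synonym param_alg = "param_poly fract alg_closure"
type_synonym ratfun = "param_alg poly fract"
type_synonym algfun = "ratfun alg_closure"

definition param_const :: "complex \<Rightarrow> param_poly" where
  "param_const c = Poly_Mapping.single 0 c"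

definition param_var :: "nat \<Rightarrow> param_poly" where
  "param_var k = Poly_Mapping.single (Poly_Mapping.single k 1) 1"

definition param_pderiv :: "nat \<Rightarrow> param_poly \<Rightarrow> param_poly" where
  "param_pderiv k p = (\<Sum>m\<in>Poly_Mapping.keys p. Poly_Mapping.single (m - Poly_Mapping.single k 1)
     (of_nat (Poly_Mapping.lookup m k) * Poly_Mapping.lookup p m))"

text \<open>\<open>K[a\<^sub>k | k \<in> J]\<close>\<close>

definition param_ring :: "complex set \<Rightarrow> nat set \<Rightarrow> param_poly set" where
  "param_ring K J = {p. (\<forall>m. Poly_Mapping.lookup p m \<in> K) \<and>
     (\<forall>m\<in>Poly_Mapping.keys p. Poly_Mapping.keys m \<subseteq> J)}"

definition param_to_alg :: "param_poly \<Rightarrow> param_alg" where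
  "param_to_alg p = to_ac (Fract p 1)"

definition const_to_alg :: "complex \<Rightarrow> param_alg" where
  "const_to_alg c = param_to_alg (param_const c)"

definition alg_to_algfun :: "param_alg \<Rightarrow> algfun" where
  "alg_to_algfun z = to_ac (Fract [:z:] 1)"

definition X_algfun :: algfun where
  "X_algfun = to_ac (Fract [:0, 1:] 1)"

definition param_to_algfun :: "param_poly \<Rightarrow> algfun" where
  "param_to_algfun p = alg_to_algfun (param_to_alg p)"

definition const_to_algfun :: "complex \<Rightarrow> algfun" where
  "const_to_algfun c = alg_to_algfun (const_to_alg c)"

text \<open>
  A polynomial in \<open>x\<close> and \<open>y\<close> has type \<open>'a poly poly\<close>, with the outer \<^type>\<open>poly\<close> for \<open>y\<close>; it is
  evaluated after mapping its coefficients along a ring embedding \<open>h\<close>.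
\<close>

definition eval_poly1 :: "('a::zero \<Rightarrow> 'b::comm_semiring_0) \<Rightarrow> 'a poly \<Rightarrow> 'b \<Rightarrow> 'b" where
  "eval_poly1 h p u = poly (map_poly h p) u"

definition eval_poly2 :: "('a::zero \<Rightarrow> 'b::comm_semiring_0) \<Rightarrow> 'a poly poly \<Rightarrow> 'b \<Rightarrow> 'b \<Rightarrow> 'b" where
  "eval_poly2 h p u v = poly (map_poly (\<lambda>q. eval_poly1 h q u) p) v"

definition coeffs1_in :: "'a::zero set \<Rightarrow> 'a poly \<Rightarrow> bool" where
  "coeffs1_in R p \<longleftrightarrow> (\<forall>i. coeff p i \<in> R)"

definition coeffs2_in :: "'a::zero set \<Rightarrow> 'a poly poly \<Rightarrow> bool" where
  "coeffs2_in R p \<longleftrightarrow> (\<forall>j. coeffs1_in R (coeff p j))"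

definition alg_over :: "complex set \<Rightarrow> param_alg \<Rightarrow> bool" where
  "alg_over K z \<longleftrightarrow> (\<exists>p. p \<noteq> 0 \<and> coeffs1_in K p \<and> eval_poly1 const_to_alg p z = 0)"

text \<open>
  \<open>D\<close> is the extension of \<open>\<partial>/\<partial>a\<^sub>k\<close> from \<open>\<complex>[a]\<close> to a derivation of the algebraic closure of \<open>\<complex>(a)\<close>;
  such an extension exists and is unique.
\<close>

definition extends_param_deriv :: "nat \<Rightarrow> (param_alg \<Rightarrow> param_alg) \<Rightarrow> bool" where
  "extends_param_deriv k D \<longleftrightarrow>
     (\<forall>u v. D (u + v) = D u + D v) \<and> (\<forall>u v. D (u * v) = D u * v + u * D v) \<and>
     (\<forall>p. D (param_to_alg p) = param_to_alg (param_pderiv k p))"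


section \<open>Residues and expansion at infinity of rational functions\<close>

text \<open>The extension of an injective ring homomorphism to the field of fractions.\<close>

definition fract_lift :: "('a::idom \<Rightarrow> 'b::field) \<Rightarrow> 'a fract \<Rightarrow> 'b" where
  "fract_lift L g = (THE s. \<exists>p q. q \<noteq> 0 \<and> g = Fract p q \<and> s = L p / L q)"

lemma fract_lift_Fract:
  assumes mult: "\<And>a b. L (a * b) = L a * L b" and nz: "\<And>a. a \<noteq> 0 \<Longrightarrow> L a \<noteq> 0" and "q \<noteq> 0"
  shows "fract_lift L (Fract p q) = L p / L q"
  unfolding fract_lift_def
proof (rule the_equality)
  show "\<exists>p' q'. q' \<noteq> 0 \<and> Fract p q = Fract p' q' \<and> L p / L q = L p' / L q'"
    using assms(3) by blast
next
  fix s assume "\<exists>p' q'. q' \<noteq> 0 \<and> Fract p q = Fract p' q' \<and> s = L p' / L q'"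
  then obtain p' q' where *: "q' \<noteq> 0" "Fract p q = Fract p' q'" "s = L p' / L q'"
    by blast
  with assms(3) have "p * q' = p' * q"
    by (simp add: eq_fract)
  hence "L p * L q' = L p' * L q" "L q \<noteq> 0" "L q' \<noteq> 0"
    using assms(3) *(1) nz by (simp_all flip: mult)
  thus "s = L p / L q"
    using *(3) by (simp add: frac_eq_eq)
qed

text \<open>The Laurent expansion at \<open>\<beta>\<close> is a series in \<open>x - \<beta>\<close>.\<close>

definition laurent_at :: "'a::field \<Rightarrow> 'a poly fract \<Rightarrow> 'a fls" where
  "laurent_at \<beta> = fract_lift (\<lambda>p. fps_to_fls (fps_of_poly (pcompose p [:\<beta>, 1:])))"

definition ratfun_res :: "'a::field \<Rightarrow> 'a poly fract \<Rightarrow> 'a" where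
  "ratfun_res \<beta> g = fls_residue (laurent_at \<beta> g)"

text \<open>
  The expansion in descending powers of \<open>x\<close> is a Laurent series in \<open>t = 1/x\<close>, obtained by
  substituting \<open>1/t\<close> for \<open>x\<close>; the coefficient of \<open>1/x\<close> is that of \<open>t\<close>.
\<close>

definition laurent_at_inf :: "'a::field poly fract \<Rightarrow> 'a fls" where
  "laurent_at_inf = fract_lift (\<lambda>p. poly (map_poly fls_const p) fls_X_inv)"

definition ratfun_Pi :: "'a::field poly fract \<Rightarrow> 'a" where
  "ratfun_Pi g = fls_nth (laurent_at_inf g) 1"

lemma laurent_at_Fract:
  assumes "q \<noteq> 0"
  shows "laurent_at \<beta> (Fract p q) =
    fps_to_fls (fps_of_poly (pcompose p [:\<beta>, 1:])) / fps_to_fls (fps_of_poly (pcompose q [:\<beta>, 1:]))"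
  unfolding laurent_at_def
  by (rule fract_lift_Fract)
     (use assms in \<open>auto simp: pcompose_mult fps_of_poly_mult fls_times_fps_to_fls pcompose_eq_0_iff\<close>)

lemma poly_map_fls_const_mult:
  "poly (map_poly fls_const (p * q)) s
     = poly (map_poly fls_const p) s * poly (map_poly fls_const (q :: 'a::field poly)) s"
proof -
  have "map_poly fls_const (p * q) = map_poly fls_const p * map_poly fls_const q"
  proof (rule poly_eqI)
    have fls_const_sum: "fls_const (sum g A) = (\<Sum>i\<in>A. fls_const (g i))" for g :: "nat \<Rightarrow> 'a" and A
      by (induction A rule: infinite_finite_induct) (auto simp flip: fls_plus_const)
    fix n
    show "coeff (map_poly fls_const (p * q)) n = coeff (map_poly fls_const p * map_poly fls_const q) n"
      by (simp add: coeff_map_poly coeff_mult fls_const_sum fls_const_mult_const)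
  qed
  thus ?thesis by simp
qed

lemma poly_map_fls_const_X_inv_nz:
  assumes "(p :: 'a::field poly) \<noteq> 0"
  shows "poly (map_poly fls_const p) fls_X_inv \<noteq> 0"
proof -
  have "fls_nth (poly (map_poly fls_const p) fls_X_inv) (- int (Polynomial.degree p))
      = (\<Sum>i\<le>Polynomial.degree p. fls_nth (fls_const (coeff p i) * fls_X_inv ^ i) (- int (Polynomial.degree p)))"
    by (simp add: poly_altdef degree_map_poly coeff_map_poly fls_nth_sum)
  also have "\<dots> = (\<Sum>i\<le>Polynomial.degree p. if i = Polynomial.degree p then coeff p i else 0)"
    by (intro sum.cong) (auto simp: fls_X_inv_power_nth)
  also have "\<dots> = lead_coeff p"
    by simp
  finally show ?thesis
    using assms by (metis fls_zero_nth leading_coeff_0_iff)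
qed

lemma laurent_at_inf_Fract:
  assumes "q \<noteq> 0"
  shows "laurent_at_inf (Fract p q) =
    poly (map_poly fls_const p) fls_X_inv / poly (map_poly fls_const q) fls_X_inv"
  unfolding laurent_at_inf_def
  by (rule fract_lift_Fract) (use assms poly_map_fls_const_mult poly_map_fls_const_X_inv_nz in auto)

lemma ratfun_res_simple_pole: "ratfun_res \<beta> (Fract [:c:] [:-\<beta>, 1:]) = c"
  by (simp add: ratfun_res_def laurent_at_Fract pcompose_pCons fps_of_poly_const divide_inverse fls_inverse_X)

lemma ratfun_Pi_inverse_X: "ratfun_Pi (Fract [:c:] [:0, 1:]) = c"
  by (simp add: ratfun_Pi_def laurent_at_inf_Fract map_poly_pCons divide_inverse fls_inverse_X_inv)


section \<open>The form \<open>S(x)\<close>\<close>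

text \<open>
  The coefficient of \<open>da\<^sub>k\<close> in \<open>S(x)\<close>, where \<open>f = g/h\<close> and \<open>y 1, \<dots>, y n\<close> are the roots of \<open>\<chi>\<close> over
  \<open>K(x)\<close>. The sum is formed in \<^typ>\<open>algfun\<close>; being symmetric in the roots it lies in the image of
  \<^typ>\<open>ratfun\<close>, and \<^const>\<open>of_ac\<close> pulls it back.
\<close>

definition S_coeff ::
    "complex poly poly \<Rightarrow> complex poly poly \<Rightarrow> param_poly poly poly \<Rightarrow> nat \<Rightarrow> (nat \<Rightarrow> algfun) \<Rightarrow> nat \<Rightarrow> ratfun"
  where
  "S_coeff g h \<theta> n y k = of_ac (\<Sum>l=1..n.
     eval_poly2 const_to_algfun g X_algfun (y l) / eval_poly2 const_to_algfun h X_algfun (y l) *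
     (eval_poly2 param_to_algfun (map_poly (map_poly (param_pderiv k)) \<theta>) X_algfun (y l) /
      eval_poly2 param_to_algfun \<theta> X_algfun (y l)))"

end

theory Submission
  imports Defs "Jordan_Normal_Form.Char_Poly"
begin

text \<open>
  The determinant \<open>r\<close> of multiplication by \<open>\<theta>\<close> modulo \<open>\<chi>\<close> is the product of the values of \<open>\<theta>\<close> at
  the roots of \<open>\<chi>\<close>, both over the rational functions and after specialising \<open>x\<close> to a root \<open>\<xi>\<close> of \<open>F\<close>, and
  the adjugate matrix gives \<open>Q\<close>, \<open>P\<close> with \<open>Q \<theta> + P \<chi> = r\<close>. Hence \<open>1/\<theta>\<close> may be replaced by \<open>Q/r\<close> in
  \<open>S\<close>, and the Euler-Lagrange formula for \<open>\<Sum> G(y\<^sub>l)/\<chi>'(y\<^sub>l)\<close> shows that \<open>S = T/(f2 F0 F)\<close> with \<open>T\<close>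
  polynomial in \<open>x\<close>. The residue theorem on the projective line turns the right-hand side into minus
  the sum of the residues of \<open>S\<close> at the roots \<open>\<xi>\<close> of \<open>F\<close>. These poles are simple, so each residue is
  \<open>T(\<xi>)/(f2 F0 F')(\<xi>)\<close>, and the same formula at \<open>x = \<xi>\<close> writes \<open>T(\<xi>)\<close> as a sum over the roots \<open>\<eta>\<close>
  of \<open>\<chi>(\<xi>, y)\<close>. There \<open>Q = 0\<close> unless \<open>\<theta>(\<xi>, \<eta>) = 0\<close>, and differentiating \<open>r(\<xi>) = 0\<close> with respect to
  the parameters gives \<open>Q \<delta>\<theta> = - F0 F' d\<xi>\<close> at the common zeros.
\<close>

section \<open>The norm of a polynomial modulo a monic polynomial\<close>

text \<open>Pseudo-division scales \<open>p\<close> by a power of the leading coefficient, here 1,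
  so it is true division although the coefficients only form an integral domain.\<close>

lemma pseudo_mod_monic:
  fixes p q :: "'a::idom poly"
  assumes "lead_coeff q = 1"
  shows "\<exists>s. p = q * s + pseudo_mod p q"
proof -
  obtain s r where sr: "pseudo_divmod p q = (s, r)" by fastforce
  have "q \<noteq> 0" using assms by auto
  from pseudo_divmod(1)[OF this sr] show ?thesis
    using sr assms by (auto simp: pseudo_mod_def)
qed

lemma coeff_pseudo_mod_eq_0:
  fixes p q :: "'a::idom poly"
  assumes "lead_coeff q = 1" "degree q \<le> i"
  shows "coeff (pseudo_mod p q) i = 0"
proof -
  have "q \<noteq> 0" using assms by auto
  from pseudo_mod(2)[OF this, of p] show ?thesis
    using assms by (auto intro: coeff_eq_0)
qed

lemma poly_eq_sum_lessThan:
  fixes p :: "'a::comm_ring_1 poly"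
  assumes "\<And>i. n \<le> i \<Longrightarrow> coeff p i = 0"
  shows "poly p x = (\<Sum>i<n. coeff p i * x ^ i)"
proof -
  have "poly p x = (\<Sum>i\<le>degree p. coeff p i * x ^ i)" by (rule poly_altdef)
  also have "\<dots> = (\<Sum>i\<in>{..degree p} \<inter> {..<n}. coeff p i * x ^ i)"
    using assms by (intro sum.mono_neutral_right) (auto simp: not_less)
  also have "\<dots> = (\<Sum>i<n. coeff p i * x ^ i)"
    by (intro sum.mono_neutral_left) (auto intro: le_degree)
  finally show ?thesis .
qed

text \<open>Reduction by \<open>pseudo_mod\<close> keeps the entries in the coefficient ring, so
  that the determinant can be specialised along any ring homomorphism.\<close>

definition mult_mat :: "'a::idom poly \<Rightarrow> 'a poly \<Rightarrow> 'a mat" where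
  "mult_mat \<chi> \<theta> = mat (degree \<chi>) (degree \<chi>) (\<lambda>(i, j). coeff (pseudo_mod (monom 1 j * \<theta>) \<chi>) i)"

definition poly_norm :: "'a::idom poly \<Rightarrow> 'a poly \<Rightarrow> 'a" where
  "poly_norm \<chi> \<theta> = det (mult_mat \<chi> \<theta>)"

lemma mult_mat_carrier [simp]: "mult_mat \<chi> \<theta> \<in> carrier_mat (degree \<chi>) (degree \<chi>)"
  by (simp add: mult_mat_def)

text \<open>Everything is linear in \<open>v\<close>, and column \<open>j\<close> of the matrix is
  congruent to \<open>y^j \<theta>\<close> modulo \<open>\<chi>\<close>.\<close>

lemma mult_mat_mult_vec:
  fixes \<chi> \<theta> :: "'a::idom poly"
  assumes "lead_coeff \<chi> = 1" "v \<in> carrier_vec (degree \<chi>)"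
  shows "\<chi> dvd (\<Sum>j<degree \<chi>. monom (v $ j) j) * \<theta> -
           (\<Sum>i<degree \<chi>. monom ((mult_mat \<chi> \<theta> *\<^sub>v v) $ i) i)"
proof -
  let ?n = "degree \<chi>"
  define R where "R j = pseudo_mod (monom 1 j * \<theta>) \<chi>" for j
  have R: "\<chi> dvd monom 1 j * \<theta> - R j" for j
    using pseudo_mod_monic[OF assms(1), of "monom 1 j * \<theta>"] unfolding R_def
    by (metis add_diff_cancel_right' dvd_triv_left)
  have "(\<Sum>i<?n. monom ((mult_mat \<chi> \<theta> *\<^sub>v v) $ i) i) = (\<Sum>j<?n. smult (v $ j) (R j))"
  proof (rule poly_eqI)
    fix m
    have "coeff (\<Sum>i<?n. monom ((mult_mat \<chi> \<theta> *\<^sub>v v) $ i) i) m =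
        (if m < ?n then (mult_mat \<chi> \<theta> *\<^sub>v v) $ m else 0)"
      by (simp add: coeff_sum)
    also have "\<dots> = (if m < ?n then (\<Sum>j<?n. coeff (R j) m * v $ j) else 0)"
      using assms(2) by (auto simp: mult_mat_def scalar_prod_def R_def atLeast0LessThan intro!: sum.cong)
    also have "\<dots> = coeff (\<Sum>j<?n. smult (v $ j) (R j)) m"
      using assms(1) by (auto simp: coeff_sum R_def coeff_pseudo_mod_eq_0 mult.commute not_less)
    finally show "coeff (\<Sum>i<?n. monom ((mult_mat \<chi> \<theta> *\<^sub>v v) $ i) i) m =
        coeff (\<Sum>j<?n. smult (v $ j) (R j)) m" .
  qed
  moreover have "(\<Sum>j<?n. monom (v $ j) j) * \<theta> = (\<Sum>j<?n. smult (v $ j) (monom 1 j * \<theta>))"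
    by (auto simp: sum_distrib_right smult_monom simp flip: mult_smult_left intro!: sum.cong)
  moreover have "\<chi> dvd (\<Sum>j<?n. smult (v $ j) (monom 1 j * \<theta> - R j))"
    by (intro dvd_sum dvd_smult R)
  ultimately show ?thesis
    by (simp add: smult_diff_right sum_subtractf)
qed

text \<open>The first column \<open>v\<close> of the adjugate satisfies
  \<open>M v = det M * e0\<close>, and \<open>e0\<close> is the coefficient vector of the polynomial
  1. Hence the polynomial with coefficients \<open>v\<close> serves as \<open>Q\<close>.\<close>

lemma poly_norm_combination:
  fixes \<chi> \<theta> :: "'a::idom poly"
  assumes "lead_coeff \<chi> = 1" "degree \<chi> > 0"
  shows "\<exists>Q P. Q * \<theta> + P * \<chi> = [:poly_norm \<chi> \<theta>:]"
proof -
  let ?n = "degree \<chi>" and ?M = "mult_mat \<chi> \<theta>"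
  define v where "v = adj_mat ?M *\<^sub>v unit_vec ?n 0"
  have v: "v \<in> carrier_vec ?n"
    unfolding v_def using adj_mat(1)[of ?M ?n] by simp
  have "?M *\<^sub>v v = (?M * adj_mat ?M) *\<^sub>v unit_vec ?n 0"
    unfolding v_def by (subst assoc_mult_mat_vec[of _ ?n ?n _ ?n]) (use adj_mat(1)[of ?M ?n] in simp_all)
  also have "\<dots> = poly_norm \<chi> \<theta> \<cdot>\<^sub>v unit_vec ?n 0"
    by (subst adj_mat(2)[of ?M ?n]) (auto simp: poly_norm_def)
  finally have "(\<Sum>i<?n. monom ((?M *\<^sub>v v) $ i) i) = (\<Sum>i<?n. if i = 0 then [:poly_norm \<chi> \<theta>:] else 0)"
    by (intro sum.cong) (auto simp: monom_0)
  also have "\<dots> = [:poly_norm \<chi> \<theta>:]"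
    using assms(2) by simp
  finally have "\<chi> dvd (\<Sum>j<?n. monom (v $ j) j) * \<theta> - [:poly_norm \<chi> \<theta>:]"
    using mult_mat_mult_vec[OF assms(1) v, of \<theta>] by simp
  then obtain s where "(\<Sum>j<?n. monom (v $ j) j) * \<theta> - [:poly_norm \<chi> \<theta>:] = \<chi> * s" ..
  hence "(\<Sum>j<?n. monom (v $ j) j) * \<theta> + (- s) * \<chi> = [:poly_norm \<chi> \<theta>:]"
    by (simp add: algebra_simps)
  thus ?thesis by blast
qed

text \<open>A kernel vector of the matrix is a nonzero \<open>p\<close> of degree below that of
  \<open>\<chi>\<close> with \<open>\<chi>\<close> dividing \<open>p * \<theta>\<close>; primality
  would make \<open>\<chi>\<close> divide \<open>p\<close>.\<close>

lemma poly_norm_nonzero: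
  fixes \<chi> \<theta> :: "'a::idom poly"
  assumes "lead_coeff \<chi> = 1" "prime_elem \<chi>" "\<not> \<chi> dvd \<theta>"
  shows "poly_norm \<chi> \<theta> \<noteq> 0"
proof
  let ?n = "degree \<chi>"
  assume "poly_norm \<chi> \<theta> = 0"
  then obtain v where v: "v \<in> carrier_vec ?n" "v \<noteq> 0\<^sub>v ?n" "mult_mat \<chi> \<theta> *\<^sub>v v = 0\<^sub>v ?n"
    using det_0_iff_vec_prod_zero[of "mult_mat \<chi> \<theta>" ?n] by (auto simp: poly_norm_def)
  define p where "p = (\<Sum>j<?n. monom (v $ j) j)"
  have coeff_p: "coeff p m = (if m < ?n then v $ m else 0)" for m
    by (simp add: p_def coeff_sum)
  have "(\<Sum>i<?n. monom ((mult_mat \<chi> \<theta> *\<^sub>v v) $ i) i) = 0"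
    by (intro sum.neutral) (simp add: v(3))
  hence "\<chi> dvd p * \<theta>"
    using mult_mat_mult_vec[OF assms(1) v(1), of \<theta>] unfolding p_def by simp
  hence "\<chi> dvd p"
    using assms(2,3) prime_elem_dvd_mult_iff by blast
  moreover have "p \<noteq> 0"
  proof
    assume "p = 0"
    hence "v $ m = 0" if "m < ?n" for m using coeff_p[of m] that by simp
    thus False using v(1,2) by auto
  qed
  ultimately have "?n \<le> degree p" by (rule dvd_imp_degree_le)
  hence "lead_coeff p = 0" using coeff_p by simp
  thus False using \<open>p \<noteq> 0\<close> by simp
qed

text \<open>Here \<open>d\<close> depends on \<open>x\<close> only: wherever it is nonzero,
  \<open>h\<close> cannot vanish at a root of \<open>\<chi>\<close>. It is applied to
  \<open>pderiv \<chi>\<close> and to the denominator of \<open>f\<close>.\<close>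

lemma poly_norm_bezout:
  fixes \<chi> h :: "complex poly poly"
  assumes "lead_coeff \<chi> = 1" "irreducible \<chi>" "\<not> \<chi> dvd h"
  obtains U V d where "d \<noteq> 0" "V * h + U * \<chi> = [:d:]"
proof -
  have "degree \<chi> > 0"
  proof (rule ccontr)
    assume "\<not> degree \<chi> > 0"
    then obtain a where "\<chi> = [:a:]" by (auto elim: degree_eq_zeroE)
    with assms(1) have "\<chi> = 1" by (simp add: one_pCons)
    thus False using assms(2) by simp
  qed
  from poly_norm_combination[OF assms(1) this, of h] that[of "poly_norm \<chi> h"]
  show ?thesis
    using poly_norm_nonzero[OF assms(1) irreducible_imp_prime_poly[OF assms(2)] assms(3)] by blast
qed

text \<open>
  With \<open>V\<close> the Vandermonde matrix of the roots and \<open>\<Delta>\<close> the diagonal matrix of the values of \<open>\<theta>\<close>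
  at them, \<open>V M = \<Delta> V\<close> for the matrix \<open>M\<close> of multiplication by \<open>\<theta>\<close>, and \<open>V\<close> is invertible.
\<close>

lemma hom_poly_norm_eq_prod:
  fixes \<chi> \<theta> :: "'a::idom poly" and \<phi> :: "'a \<Rightarrow> 'b::field"
  assumes "comm_ring_hom \<phi>" and monic: "lead_coeff \<chi> = 1"
    and E: "E = {z. poly (map_poly \<phi> \<chi>) z = 0}" "card E = degree \<chi>" "degree \<chi> > 0"
  shows "\<phi> (poly_norm \<chi> \<theta>) = (\<Prod>e\<in>E. poly (map_poly \<phi> \<theta>) e)"
proof -
  interpret comm_ring_hom \<phi> by fact
  interpret mp: map_poly_comm_ring_hom \<phi> ..
  let ?n = "degree \<chi>" and ?M = "map_mat \<phi> (mult_mat \<chi> \<theta>)"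
  have "finite E" using E(2,3) by (metis card_ge_0_finite)
  then obtain e where e: "bij_betw e {0..<?n} E"
    using ex_bij_betw_nat_finite[of E] E(2) by auto
  have root: "poly (map_poly \<phi> \<chi>) (e l) = 0" if "l < ?n" for l
    using e that E(1) by (auto simp: bij_betw_def)
  define V where "V = mat ?n ?n (\<lambda>(l, i). e l ^ i)"
  define \<Delta> where "\<Delta> = mat ?n ?n (\<lambda>(i, j). if i = j then poly (map_poly \<phi> \<theta>) (e i) else 0)"
  have [simp]: "V \<in> carrier_mat ?n ?n" "\<Delta> \<in> carrier_mat ?n ?n" "?M \<in> carrier_mat ?n ?n"
    by (auto simp: V_def \<Delta>_def)
  have VM: "V * ?M = \<Delta> * V"
  proof (rule eq_matI)
    fix l j assume "l < dim_row (\<Delta> * V)" "j < dim_col (\<Delta> * V)"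
    hence lj: "l < ?n" "j < ?n" by (auto simp: V_def \<Delta>_def)
    define R where "R = pseudo_mod (monom 1 j * \<theta>) \<chi>"
    obtain s where s: "monom 1 j * \<theta> = \<chi> * s + R"
      using pseudo_mod_monic[OF monic, of "monom 1 j * \<theta>"] unfolding R_def by blast
    have "(V * ?M) $$ (l, j) = (\<Sum>i<?n. coeff (map_poly \<phi> R) i * e l ^ i)"
      using lj by (simp add: V_def mult_mat_def scalar_prod_def R_def atLeast0LessThan mult.commute)
    also have "\<dots> = poly (map_poly \<phi> R) (e l)"
      by (rule poly_eq_sum_lessThan[symmetric]) (simp add: R_def coeff_pseudo_mod_eq_0[OF monic])
    \<comment> \<open>Reduction modulo \<open>\<chi>\<close> does not change the value at a root of
      \<open>\<chi>\<close>.\<close>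
    also have "\<dots> = poly (map_poly \<phi> (monom 1 j * \<theta>)) (e l)"
      using root[OF lj(1)] unfolding s by (simp add: hom_distribs)
    also have "\<dots> = e l ^ j * poly (map_poly \<phi> \<theta>) (e l)"
      by (simp add: hom_distribs poly_monom)
    also have "\<dots> = (\<Sum>i<?n. if i = l then poly (map_poly \<phi> \<theta>) (e l) * e l ^ j else 0)"
      using lj by (simp add: mult.commute)
    also have "\<dots> = (\<Delta> * V) $$ (l, j)"
      using lj by (simp add: V_def \<Delta>_def scalar_prod_def atLeast0LessThan if_distrib[of "\<lambda>x. x * _"]
          eq_commute[of l] cong: if_cong)
    finally show "(V * ?M) $$ (l, j) = (\<Delta> * V) $$ (l, j)" .
  qed (auto simp: V_def \<Delta>_def mult_mat_def)
  \<comment> \<open>A kernel vector of \<open>V\<close> would be a nonzero polynomial of degree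
    below \<open>?n\<close> vanishing on all \<open>?n\<close> elements of \<open>E\<close>.\<close>
  have "det V \<noteq> 0"
  proof
    assume "det V = 0"
    then obtain v where v: "v \<in> carrier_vec ?n" "v \<noteq> 0\<^sub>v ?n" "V *\<^sub>v v = 0\<^sub>v ?n"
      using det_0_iff_vec_prod_zero[of V ?n] by auto
    define p where "p = (\<Sum>j<?n. monom (v $ j) j)"
    have coeff_p: "coeff p m = (if m < ?n then v $ m else 0)" for m
      by (simp add: p_def coeff_sum)
    have "poly p (e l) = 0" if l: "l < ?n" for l
    proof -
      have "poly p (e l) = (V *\<^sub>v v) $ l"
        using l v(1) by (simp add: p_def poly_sum poly_monom V_def scalar_prod_def atLeast0LessThan mult.commute)
      thus ?thesis using l by (simp add: v(3))
    qed
    hence "E \<subseteq> {z. poly p z = 0}"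
      using e by (auto simp: bij_betw_def)
    moreover have "p \<noteq> 0"
    proof
      assume "p = 0"
      hence "v $ m = 0" if "m < ?n" for m using coeff_p[of m] that by simp
      thus False using v(1,2) by auto
    qed
    moreover from this have "degree p < ?n"
      using coeff_p[of "degree p"] by (auto split: if_splits)
    ultimately show False
      using card_mono[OF poly_roots_finite[of p], of E] card_poly_roots_bound[of p] E(2) by linarith
  qed
  have "det V * \<phi> (poly_norm \<chi> \<theta>) = det (V * ?M)"
    by (subst det_mult[of _ ?n]) (simp_all add: poly_norm_def)
  also have "\<dots> = det \<Delta> * det V"
    unfolding VM by (rule det_mult[of _ ?n]) simp_all
  also have "det \<Delta> = (\<Prod>l\<in>{0..<?n}. poly (map_poly \<phi> \<theta>) (e l))"
    by (subst det_upper_triangular[of _ ?n]) (auto simp: \<Delta>_def diag_mat_def prod.list_conv_set_nth intro!: prod.cong)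
  also have "\<dots> = (\<Prod>e\<in>E. poly (map_poly \<phi> \<theta>) e)"
    by (rule prod.reindex_bij_betw[OF e])
  finally show ?thesis using \<open>det V \<noteq> 0\<close> by simp
qed

section \<open>Polynomials with simple roots\<close>

text \<open>A root occurring twice in the factorisation into linear factors would also be a root of
  the derivative.\<close>

lemma card_roots_eq_degree:
  fixes p :: "'a::alg_closed_field poly"
  assumes "p \<noteq> 0" "\<And>z. poly p z = 0 \<Longrightarrow> poly (pderiv p) z \<noteq> 0"
  shows "card {z. poly p z = 0} = degree p"
proof -
  obtain A where A: "size A = degree p" "p = smult (lead_coeff p) (\<Prod>x\<in>#A. [:- x, 1:])"
    using alg_closed_imp_factorization[OF assms(1)] by blast
  have roots: "{z. poly p z = 0} = set_mset A"
    using assms(1) by (subst A(2)) (auto simp: poly_prod_mset prod_mset_zero_iff)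
  have "count A x = 1" if x: "x \<in># A" for x
  proof (rule ccontr)
    assume "count A x \<noteq> 1"
    then obtain B where "A = {#x, x#} + B"
      using x by (metis One_nat_def add_mset_add_single count_add_mset count_eq_zero_iff
          insert_DiffM multi_member_split union_mset_add_mset_left add_0)
    hence "p = smult (lead_coeff p) ([:-x, 1:] * ([:-x, 1:] * (\<Prod>x\<in>#B. [:- x, 1:])))"
      using A(2) by simp
    then obtain q where "p = [:-x, 1:] * ([:-x, 1:] * q)"
      by (metis mult_smult_right)
    hence "poly p x = 0" "poly (pderiv p) x = 0"
      by (simp_all add: pderiv_mult del: mult_pCons_left)
    thus False using assms(2) by blast
  qed
  hence "card (set_mset A) = size A"
    by (simp add: size_multiset_overloaded_eq)
  thus ?thesis using A(1) roots by simp
qed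

text \<open>Lagrange interpolation at the roots writes \<open>q\<close> as a combination of the
  monic products \<open>w e\<close> of degree \<open>degree p - 1\<close>; the top coefficients are
  then compared.\<close>

lemma sum_over_simple_roots:
  fixes p q :: "'a::field poly"
  assumes monic: "lead_coeff p = 1" and E: "E = {z. poly p z = 0}" "card E = degree p"
    and q: "\<And>i. degree p \<le> i \<Longrightarrow> coeff q i = 0" and pos: "degree p > 0"
  shows "(\<Sum>e\<in>E. poly q e / poly (pderiv p) e) = coeff q (degree p - 1)"
proof -
  let ?n = "degree p"
  have fin: "finite E" using E(2) pos by (metis card_ge_0_finite)
  define w where "w e = (\<Prod>e'\<in>E-{e}. [:-e', 1:])" for e
  have deg_w: "degree (w e) = ?n - 1" if "e \<in> E" for e
    using that fin E(2) unfolding w_def by (simp add: degree_prod_eq_sum_degree)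
  have lead_w: "lead_coeff (w e) = 1" for e
    unfolding w_def by (simp add: lead_coeff_prod)
  \<comment> \<open>The difference of two monic polynomials of degree \<open>?n\<close> has smaller
    degree, yet it has the \<open>?n\<close> roots in \<open>E\<close>.\<close>
  have p_eq: "p = (\<Prod>e\<in>E. [:-e, 1:])"
  proof (rule ccontr)
    define d where "d = p - (\<Prod>e\<in>E. [:-e, 1:])"
    assume "p \<noteq> (\<Prod>e\<in>E. [:-e, 1:])"
    hence "d \<noteq> 0" by (simp add: d_def)
    have deg: "degree (\<Prod>e\<in>E. [:-e, 1:]) = ?n" "lead_coeff (\<Prod>e\<in>E. [:-e, 1:]) = 1"
      using E(2) by (simp add: degree_prod_eq_sum_degree, simp only: lead_coeff_prod, simp)
    have "degree d \<le> ?n"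
      unfolding d_def using deg(1) by (intro degree_diff_le) auto
    moreover have "coeff d ?n = 0"
      unfolding d_def using deg monic by (metis coeff_diff diff_self)
    ultimately have "degree d < ?n"
      using \<open>d \<noteq> 0\<close> by (metis le_neq_implies_less leading_coeff_0_iff)
    moreover have "E \<subseteq> {z. poly d z = 0}"
      using E(1) fin by (auto simp: d_def poly_prod)
    ultimately show False
      using card_mono[OF poly_roots_finite[OF \<open>d \<noteq> 0\<close>], of E] card_poly_roots_bound[OF \<open>d \<noteq> 0\<close>] E(2)
      by linarith
  qed
  have w_at: "poly (w e) e' = (if e' = e then poly (pderiv p) e else 0)" if "e \<in> E" "e' \<in> E" for e e'
  proof (cases "e' = e")
    case True
    \<comment> \<open>By the product rule; every \<open>w a\<close> with \<open>a\<close> different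
      from \<open>e\<close> still contains the factor vanishing at \<open>e\<close>.\<close>
    have "poly (pderiv p) e = (\<Sum>a\<in>E. poly (w a) e)"
      unfolding p_eq pderiv_prod w_def by (simp add: poly_sum pderiv_pCons)
    also have "\<dots> = (\<Sum>a\<in>{e}. poly (w a) e)"
      using that fin by (intro sum.mono_neutral_right) (auto simp: w_def poly_prod)
    finally show ?thesis using True by simp
  next
    case False
    thus ?thesis using that fin by (auto simp: w_def poly_prod)
  qed
  have nz: "poly (pderiv p) e \<noteq> 0" if "e \<in> E" for e
    using w_at[OF that that] fin by (auto simp: w_def poly_prod)
  define L where "L = (\<Sum>e\<in>E. smult (poly q e / poly (pderiv p) e) (w e))"
  have L_at: "poly L e = poly q e" if "e \<in> E" for e
  proof -
    have "poly L e = (\<Sum>a\<in>E. if a = e then poly q e else 0)"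
      unfolding L_def using that w_at nz by (auto simp: poly_sum intro!: sum.cong)
    thus ?thesis using that fin by simp
  qed
  have coeff_L: "coeff L i = 0" if "i \<ge> ?n" for i
    unfolding L_def using deg_w that pos by (auto simp: coeff_sum intro!: sum.neutral coeff_eq_0)
  have "L = q"
  proof (rule ccontr)
    assume "L \<noteq> q"
    hence "L - q \<noteq> 0" by simp
    moreover from this have "degree (L - q) < ?n"
      using coeff_L q by (metis coeff_diff diff_self leading_coeff_0_iff not_less)
    moreover have "E \<subseteq> {z. poly (L - q) z = 0}"
      using L_at by auto
    ultimately show False
      using card_mono[OF poly_roots_finite, of "L - q" E] card_poly_roots_bound[of "L - q"] E(2)
      by linarith
  qed
  have "coeff L (?n - 1) = (\<Sum>e\<in>E. poly q e / poly (pderiv p) e)"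
    unfolding L_def coeff_sum
    by (intro sum.cong refl) (use deg_w lead_w in \<open>metis coeff_smult mult.right_neutral\<close>)
  thus ?thesis using \<open>L = q\<close> by simp
qed

section \<open>The residue theorem for rational functions\<close>

lemma fract_lift_add:
  assumes mult: "\<And>a b. L (a * b) = L a * L b" and nz: "\<And>a. a \<noteq> 0 \<Longrightarrow> L a \<noteq> 0"
    and add: "\<And>a b. L (a + b) = L a + L b"
  shows "fract_lift L (u + v) = fract_lift L u + fract_lift L v"
proof -
  obtain p q where u: "u = Fract p q" "q \<noteq> 0" by (cases u)
  obtain p' q' where v: "v = Fract p' q'" "q' \<noteq> 0" by (cases v)
  have "fract_lift L (u + v) = fract_lift L (Fract (p * q' + p' * q) (q * q'))"
    using u v by simp
  also have "\<dots> = (L p * L q' + L p' * L q) / (L q * L q')"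
    by (subst fract_lift_Fract[OF mult nz]) (use u v in \<open>auto simp: mult add\<close>)
  also have "\<dots> = L p / L q + L p' / L q'"
    using u v nz by (simp add: add_frac_eq)
  also have "\<dots> = fract_lift L u + fract_lift L v"
    using u v by (simp add: fract_lift_Fract[OF mult nz])
  finally show ?thesis .
qed

lemma laurent_at_add: "laurent_at b (u + v) = laurent_at b u + laurent_at b v"
  unfolding laurent_at_def
  by (rule fract_lift_add)
     (auto simp: pcompose_mult pcompose_add fps_of_poly_mult fps_of_poly_add fls_times_fps_to_fls
        pcompose_eq_0_iff)

lemma laurent_at_inf_add: "laurent_at_inf (u + v) = laurent_at_inf u + laurent_at_inf v"
proof -
  have "map_poly fls_const (p + q) = map_poly fls_const p + map_poly fls_const q" for p q :: "'a poly"
    by (rule poly_eqI) (simp add: coeff_map_poly fls_plus_const)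
  thus ?thesis
    unfolding laurent_at_inf_def
    by (intro fract_lift_add) (auto simp: poly_map_fls_const_mult poly_map_fls_const_X_inv_nz)
qed

lemma ratfun_res_add: "ratfun_res b (u + v) = ratfun_res b u + ratfun_res b v"
  by (simp add: ratfun_res_def laurent_at_add)

lemma ratfun_Pi_add: "ratfun_Pi (u + v) = ratfun_Pi u + ratfun_Pi v"
  by (simp add: ratfun_Pi_def laurent_at_inf_add)

text \<open>The expanded denominator has nonzero constant term, so the quotient is a power
  series.\<close>

lemma ratfun_res_regular:
  assumes "poly q b \<noteq> 0"
  shows "ratfun_res b (Fract p q) = 0"
proof -
  have "q \<noteq> 0" using assms by auto
  have "fps_nth (fps_of_poly (pcompose q [:b, 1:])) 0 \<noteq> 0"
    using assms by (simp add: coeff_pcompose_0 poly_0_coeff_0[symmetric] poly_pcompose)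
  hence "subdegree (fps_of_poly (pcompose q [:b, 1:])) = 0"
    by (simp add: subdegree_eq_0)
  thus ?thesis
    using \<open>q \<noteq> 0\<close> by (simp add: ratfun_res_def laurent_at_Fract fls_divide_fps_to_fls)
qed

lemma ratfun_res_simple_root:
  fixes p q :: "'a::field poly"
  assumes "poly q b = 0" "poly (pderiv q) b \<noteq> 0"
  shows "ratfun_res b (Fract p q) = poly p b / poly (pderiv q) b"
proof -
  obtain q1 where q: "q = [:-b, 1:] * q1"
    using assms(1) by (metis dvdE poly_eq_0_iff_dvd)
  have q': "poly (pderiv q) b = poly q1 b"
    unfolding q by (simp add: pderiv_mult pderiv_pCons del: mult_pCons_left)
  with assms(2) have nz: "poly q1 b \<noteq> 0" "q1 \<noteq> 0" by auto
  \<comment> \<open>This value makes \<open>p - c q1\<close> vanish at \<open>b\<close>, so that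
    subtracting \<open>c/(x - b)\<close> leaves a function regular at \<open>b\<close>.\<close>
  define c where "c = poly p b / poly q1 b"
  have "poly (p - smult c q1) b = 0" using nz by (simp add: c_def)
  then obtain s where s: "p - smult c q1 = [:-b, 1:] * s"
    by (metis dvdE poly_eq_0_iff_dvd)
  hence p: "p = [:-b, 1:] * s + [:c:] * q1" by (simp add: algebra_simps)
  have "Fract p q = Fract s q1 + Fract [:c:] [:-b, 1:]"
    using nz unfolding p q by (simp add: eq_fract algebra_simps del: mult_pCons_left)
  hence "ratfun_res b (Fract p q) = c"
    using ratfun_res_regular[OF nz(1)] by (simp only: ratfun_res_add ratfun_res_simple_pole add_0_left)
  thus ?thesis
    by (simp add: c_def q')
qed

section \<open>Expansion at infinity in powers of \<open>1/x\<close>\<close>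

lemma poly_map_fls_const_X_inv_nth:
  fixes p :: "'a::field poly"
  shows "fls_nth (poly (map_poly fls_const p) fls_X_inv) m = (if m \<le> 0 then coeff p (nat (- m)) else 0)"
proof -
  have "fls_nth (poly (map_poly fls_const p) fls_X_inv) m =
      (\<Sum>i\<le>degree p. fls_nth (fls_const (coeff p i) * fls_X_inv ^ i) m)"
    by (simp add: poly_altdef degree_map_poly coeff_map_poly fls_nth_sum)
  also have "\<dots> = (\<Sum>i\<le>degree p. if m \<le> 0 \<and> i = nat (- m) then coeff p i else 0)"
    by (intro sum.cong) (auto simp: fls_X_inv_power_nth)
  also have "\<dots> = (if m \<le> 0 then coeff p (nat (- m)) else 0)"
    by (auto simp: coeff_eq_0)
  finally show ?thesis .
qed

lemma poly_map_fls_const_X_inv_subdegree: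
  fixes p :: "'a::field poly"
  assumes "p \<noteq> 0"
  shows "fls_subdegree (poly (map_poly fls_const p) fls_X_inv) = - int (degree p)"
  using assms
  by (intro fls_subdegree_eqI) (auto simp: poly_map_fls_const_X_inv_nth coeff_eq_0)

lemma ratfun_Pi_poly: "ratfun_Pi (Fract p 1) = 0"
  by (simp add: ratfun_Pi_def laurent_at_inf_Fract poly_map_fls_const_X_inv_nth)

text \<open>In \<open>t = 1/x\<close> the expansion starts at exponent
  \<open>degree q - degree p\<close>, which is at least 2.\<close>

lemma ratfun_Pi_eq_0:
  fixes p q :: "'a::field poly"
  assumes "q \<noteq> 0" "degree p + 2 \<le> degree q"
  shows "ratfun_Pi (Fract p q) = 0"
proof (cases "p = 0")
  case False
  let ?e = "\<lambda>p::'a poly. poly (map_poly fls_const p) fls_X_inv"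
  have "fls_subdegree (?e p / ?e q) = fls_subdegree (?e p) - fls_subdegree (?e q)"
    using assms(1) False by (intro fls_divide_subdegree) (auto simp: poly_map_fls_const_X_inv_nz)
  hence "fls_subdegree (?e p / ?e q) \<ge> 2"
    using assms False by (simp add: poly_map_fls_const_X_inv_subdegree)
  thus ?thesis
    using assms(1) by (simp add: ratfun_Pi_def laurent_at_inf_Fract fls_eq0_below_subdegree)
qed (simp add: ratfun_Pi_def laurent_at_inf_Fract assms)

lemma ratfun_Pi_simple_pole: "ratfun_Pi (Fract [:c:] [:-b, 1:]) = (c::'a::field)"
proof -
  \<comment> \<open>The correction term decays like \<open>1/x^2\<close> and is invisible to
    \<open>ratfun_Pi\<close>.\<close>
  have "Fract [:c:] [:-b, 1:] = Fract [:c:] [:0, 1:] + Fract [:c * b:] ([:0, 1:] * [:-b, 1:])"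
    by (simp add: eq_fract algebra_simps)
  thus ?thesis
    by (simp only: ratfun_Pi_add ratfun_Pi_inverse_X) (simp add: ratfun_Pi_eq_0)
qed

text \<open>Any finite \<open>B\<close> outside which the residues vanish is allowed, so that the
  property is visibly closed under addition without tracking the exact poles.\<close>

definition residue_sum_eq_Pi :: "'a::field poly fract \<Rightarrow> bool" where
  "residue_sum_eq_Pi u \<longleftrightarrow>
     (\<exists>B. finite B \<and> (\<forall>b. b \<notin> B \<longrightarrow> ratfun_res b u = 0) \<and> (\<Sum>b\<in>B. ratfun_res b u) = ratfun_Pi u)"

lemma residue_sum_eq_Pi_add:
  assumes "residue_sum_eq_Pi u" "residue_sum_eq_Pi v"
  shows "residue_sum_eq_Pi (u + v)"
proof -
  obtain A where A: "finite A" "\<And>b. b \<notin> A \<Longrightarrow> ratfun_res b u = 0" "(\<Sum>b\<in>A. ratfun_res b u) = ratfun_Pi u"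
    using assms(1) unfolding residue_sum_eq_Pi_def by blast
  obtain B where B: "finite B" "\<And>b. b \<notin> B \<Longrightarrow> ratfun_res b v = 0" "(\<Sum>b\<in>B. ratfun_res b v) = ratfun_Pi v"
    using assms(2) unfolding residue_sum_eq_Pi_def by blast
  have "(\<Sum>b\<in>A\<union>B. ratfun_res b u) = ratfun_Pi u"
    unfolding A(3)[symmetric] using A B by (intro sum.mono_neutral_right) auto
  moreover have "(\<Sum>b\<in>A\<union>B. ratfun_res b v) = ratfun_Pi v"
    unfolding B(3)[symmetric] using A B by (intro sum.mono_neutral_right) auto
  ultimately show ?thesis
    unfolding residue_sum_eq_Pi_def
    by (intro exI[of _ "A \<union> B"]) (use A B in \<open>auto simp: ratfun_res_add ratfun_Pi_add sum.distrib\<close>)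
qed

lemma residue_sum_eq_Pi_poly: "residue_sum_eq_Pi (Fract p 1)"
  unfolding residue_sum_eq_Pi_def
  by (intro exI[of _ "{}"]) (simp add: ratfun_res_regular ratfun_Pi_poly)

text \<open>For \<open>m = 1\<close> both sides are \<open>c\<close>. For \<open>m > 1\<close> the
  only term at \<open>b\<close> has exponent \<open>-m\<close>, and the expansion at infinity starts
  beyond \<open>1/x\<close>, so both sides are 0.\<close>

lemma residue_sum_eq_Pi_pole:
  assumes "m > 0"
  shows "residue_sum_eq_Pi (Fract [:c:] ([:-b, 1:] ^ m))"
  unfolding residue_sum_eq_Pi_def
proof (intro exI[of _ "{b}"] conjI allI impI)
  show "ratfun_res b' (Fract [:c:] ([:-b, 1:] ^ m)) = 0" if "b' \<notin> {b}" for b'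
    using that by (intro ratfun_res_regular) auto
  show "(\<Sum>b'\<in>{b}. ratfun_res b' (Fract [:c:] ([:-b, 1:] ^ m))) = ratfun_Pi (Fract [:c:] ([:-b, 1:] ^ m))"
  proof (cases "m = 1")
    case True
    thus ?thesis by (simp add: ratfun_res_simple_pole ratfun_Pi_simple_pole)
  next
    case False
    have "pcompose ([:-b, 1:] ^ m) [:b, 1:] = [:0, 1:] ^ m"
      by (induction m) (simp_all add: pcompose_mult pcompose_pCons pcompose_1 del: mult_pCons_left)
    hence "laurent_at b (Fract [:c:] ([:-b, 1:] ^ m)) = fls_const c * fls_X_inv ^ m"
      by (simp add: laurent_at_Fract pcompose_pCons fps_of_poly_const fps_of_poly_power divide_inverse
          fls_inverse_X fps_to_fls_power flip: power_inverse)
    hence "ratfun_res b (Fract [:c:] ([:-b, 1:] ^ m)) = 0"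
      using False assms by (simp add: ratfun_res_def fls_X_inv_power_nth)
    moreover have "ratfun_Pi (Fract [:c:] ([:-b, 1:] ^ m)) = 0"
      using False assms by (intro ratfun_Pi_eq_0) (auto simp: degree_linear_power)
    ultimately show ?thesis by simp
  qed
qed simp

text \<open>
  Partial fractions: \<open>1/((x - b) (x - c))\<close> is split when \<open>b \<noteq> c\<close>, until the denominator is a power
  of one linear factor.
\<close>

lemma residue_sum_eq_Pi_prod_mset:
  fixes A :: "'a::field multiset"
  shows "residue_sum_eq_Pi (Fract p (\<Prod>x\<in>#A. [:-x, 1:]))"
proof (induction "size A" arbitrary: A p rule: less_induct)
  case less
  define P where "P A = (\<Prod>x\<in>#A. [:-x, 1:])" for A :: "'a multiset"
  have P_nz: "P A \<noteq> 0" for A by (auto simp: P_def prod_mset_zero_iff)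
  have P_add: "P (add_mset x A) = [:-x, 1:] * P A" for x A by (simp add: P_def)
  have IH: "residue_sum_eq_Pi (Fract p (P B))" if "size B < size A" for B p
    using less[of B p] that by (simp add: P_def)
  show ?case
  proof (cases "A = {#}")
    case True
    thus ?thesis by (simp add: residue_sum_eq_Pi_poly)
  next
    case False
    then obtain b B where A: "A = add_mset b B" by (meson multiset_cases)
    show ?thesis
    proof (cases "set_mset B \<subseteq> {b}")
      case True
      define m where "m = size A"
      have A': "A = replicate_mset m b"
        unfolding m_def by (rule set_mset_subset_singletonD) (use True in \<open>simp add: A\<close>)
      have m: "m > 0" "P A = [:-b, 1:] ^ m"
        unfolding A' P_def by (simp_all add: m_def A)
      \<comment> \<open>The multiple of \<open>x - b\<close> cancels one factor and falls under the
        induction hypothesis; the constant \<open>poly p b\<close> leaves a pure pole.\<close>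
      obtain s where "p - [:poly p b:] = [:-b, 1:] * s"
        using poly_eq_0_iff_dvd[of "p - [:poly p b:]" b] by (auto elim: dvdE)
      hence p: "p = [:-b, 1:] * s + [:poly p b:]" by (simp add: algebra_simps)
      have "Fract p (P A) = Fract ([:-b, 1:] * s) (P A) + Fract [:poly p b:] (P A)"
        using P_nz by (subst p) (simp add: eq_fract algebra_simps del: mult_pCons_left)
      also have "Fract ([:-b, 1:] * s) (P A) = Fract s (P B)"
        unfolding A P_add by (rule mult_fract_cancel) simp
      also have "residue_sum_eq_Pi (\<dots> + Fract [:poly p b:] (P A))"
        unfolding m(2) by (intro residue_sum_eq_Pi_add IH residue_sum_eq_Pi_pole m) (simp add: A)
      finally show ?thesis by (simp add: P_def)
    next
      case False
      then obtain c where c: "c \<in># B" "c \<noteq> b" by auto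
      then obtain C where B: "B = add_mset c C" by (meson multi_member_split)
      \<comment> \<open>As \<open>(x - c) - (x - b) = b - c\<close>, this gives
        \<open>1/((x - b) (x - c)) = k/(x - b) - k/(x - c)\<close>.\<close>
      define k where "k = inverse (b - c)"
      have k: "[:k:] * ([:-c, 1:] - [:-b, 1:]) = 1"
        using c by (simp add: k_def right_diff_distrib [symmetric] pCons_one)
      have "Fract p (P A) = Fract ([:k:] * p) (P (add_mset b C)) + Fract (- [:k:] * p) (P (add_mset c C))"
      proof -
        let ?u = "P (add_mset b C)" and ?v = "P (add_mset c C)"
        have distrib: "r * p * (x * z) + - r * p * (y * z) = p * (r * (x - y)) * z" for r x y z :: "'a poly"
          by (simp add: algebra_simps)
        have "[:k:] * p * ?v + - [:k:] * p * ?u = p * P C"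
          unfolding P_add distrib k by simp
        hence "Fract ([:k:] * p) ?u + Fract (- [:k:] * p) ?v = Fract (p * P C) (?u * ?v)"
          using P_nz by (simp only: add_fract not_False_eq_True)
        also have "\<dots> = Fract (P C * p) (P C * P A)"
          by (simp only: A B P_add ac_simps)
        also have "\<dots> = Fract p (P A)"
          using P_nz by (intro mult_fract_cancel)
        finally show ?thesis ..
      qed
      thus ?thesis
        using residue_sum_eq_Pi_add[OF IH IH, of "add_mset b C" "add_mset c C"]
        by (simp add: A B P_def)
    qed
  qed
qed

theorem sum_ratfun_res_eq_Pi:
  fixes p q :: "'a::alg_closed_field poly"
  assumes "q \<noteq> 0"
  shows "(\<Sum>b | poly q b = 0. ratfun_res b (Fract p q)) = ratfun_Pi (Fract p q)"
proof -
  obtain A where A: "q = smult (lead_coeff q) (\<Prod>x\<in>#A. [:- x, 1:])"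
    using alg_closed_imp_factorization[OF assms] by blast
  have "Fract p q = Fract (smult (inverse (lead_coeff q)) p) (\<Prod>x\<in>#A. [:- x, 1:])"
  proof (subst eq_fract)
    show "p * (\<Prod>x\<in>#A. [:- x, 1:]) = smult (inverse (lead_coeff q)) p * q"
      using assms by (subst (2) A) simp
  qed (use assms in \<open>auto simp: prod_mset_zero_iff\<close>)
  hence "residue_sum_eq_Pi (Fract p q)"
    by (simp add: residue_sum_eq_Pi_prod_mset)
  then obtain B where B: "finite B" "\<And>b. b \<notin> B \<Longrightarrow> ratfun_res b (Fract p q) = 0"
      "(\<Sum>b\<in>B. ratfun_res b (Fract p q)) = ratfun_Pi (Fract p q)"
    unfolding residue_sum_eq_Pi_def by blast
  let ?Z = "{b. poly q b = 0}"
  \<comment> \<open>Residues vanish outside \<open>B\<close> by its choice and outside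
    \<open>?Z\<close> by regularity, so either sum reduces to the intersection.\<close>
  have "(\<Sum>b\<in>?Z. ratfun_res b (Fract p q)) = (\<Sum>b\<in>?Z \<inter> B. ratfun_res b (Fract p q))"
    using B poly_roots_finite[OF assms] by (intro sum.mono_neutral_right) auto
  also have "\<dots> = (\<Sum>b\<in>B. ratfun_res b (Fract p q))"
    using B ratfun_res_regular by (intro sum.mono_neutral_left) blast+
  finally show ?thesis using B(3) by simp
qed

section \<open>The Euler-Lagrange formula along a ring homomorphism\<close>

lemma degree_map_poly_monic:
  assumes "lead_coeff p = 1" "\<phi> 0 = 0" "\<phi> 1 = 1"
  shows "degree (map_poly \<phi> p :: 'b::zero_neq_one poly) = degree p"
proof (rule antisym)
  show "degree (map_poly \<phi> p) \<le> degree p"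
    using assms(2) by (intro degree_le) (simp add: coeff_map_poly coeff_eq_0)
  show "degree p \<le> degree (map_poly \<phi> p)"
    using assms by (intro le_degree) (simp add: coeff_map_poly)
qed

text \<open>Replacing \<open>p\<close> by its remainder leaves the values at the roots unchanged.
  The element on the right before applying \<open>\<phi>\<close> does not depend on
  \<open>\<phi>\<close>, which links the generic sum with its specialisations.\<close>

lemma sum_over_simple_roots_hom:
  fixes \<chi> p :: "'a::idom poly" and \<phi> :: "'a \<Rightarrow> 'b::field"
  assumes "idom_hom \<phi>" and monic: "lead_coeff \<chi> = 1"
    and E: "E = {z. poly (map_poly \<phi> \<chi>) z = 0}" "card E = degree \<chi>" "degree \<chi> > 0"
  shows "(\<Sum>e\<in>E. poly (map_poly \<phi> p) e / poly (map_poly \<phi> (pderiv \<chi>)) e) =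
           \<phi> (coeff (pseudo_mod p \<chi>) (degree \<chi> - 1))"
proof -
  interpret idom_hom \<phi> by fact
  interpret mp: map_poly_comm_ring_hom \<phi> ..
  obtain s where s: "p = \<chi> * s + pseudo_mod p \<chi>"
    using pseudo_mod_monic[OF monic] by blast
  have deg: "degree (map_poly \<phi> \<chi>) = degree \<chi>" "lead_coeff (map_poly \<phi> \<chi>) = 1"
    using degree_map_poly_monic[OF monic, of \<phi>] monic by simp_all
  have "(\<Sum>e\<in>E. poly (map_poly \<phi> p) e / poly (map_poly \<phi> (pderiv \<chi>)) e) =
      (\<Sum>e\<in>E. poly (map_poly \<phi> (pseudo_mod p \<chi>)) e / poly (pderiv (map_poly \<phi> \<chi>)) e)"
    by (intro sum.cong refl, subst s) (auto simp: hom_distribs E(1) map_poly_pderiv)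
  also have "\<dots> = coeff (map_poly \<phi> (pseudo_mod p \<chi>)) (degree \<chi> - 1)"
    using sum_over_simple_roots[of "map_poly \<phi> \<chi>" E "map_poly \<phi> (pseudo_mod p \<chi>)"]
      deg E coeff_pseudo_mod_eq_0[OF monic] by simp
  finally show ?thesis by simp
qed

section \<open>Derivations\<close>

definition is_derivation :: "('a::comm_ring_1 \<Rightarrow> 'a) \<Rightarrow> bool" where
  "is_derivation D \<longleftrightarrow> (\<forall>u v. D (u + v) = D u + D v) \<and> (\<forall>u v. D (u * v) = D u * v + u * D v)"

lemma is_derivation_zero: "is_derivation D \<Longrightarrow> D 0 = 0"
  unfolding is_derivation_def by (metis add_cancel_right_left)

text \<open>Acting on coefficients treats the variable as a constant; used twice, this gives the
  differential with \<open>x\<close> and \<open>y\<close> held fixed.\<close>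

lemma is_derivation_map_poly:
  assumes "is_derivation D"
  shows "is_derivation (map_poly D)"
proof -
  have zero: "D 0 = 0" using assms by (rule is_derivation_zero)
  have add: "D (u + v) = D u + D v" and mult: "D (u * v) = D u * v + u * D v" for u v
    using assms by (auto simp: is_derivation_def)
  have sum: "D (sum f A) = (\<Sum>a\<in>A. D (f a))" for f :: "nat \<Rightarrow> 'a" and A
    by (induction A rule: infinite_finite_induct) (auto simp: zero add)
  show ?thesis
    unfolding is_derivation_def
    by (auto intro!: poly_eqI simp: coeff_map_poly zero add coeff_mult sum mult sum.distrib)
qed

text \<open>The chain rule, by induction along Horner's scheme.\<close>

lemma is_derivation_poly:
  assumes "is_derivation D"
  shows "D (poly p u) = poly (map_poly D p) u + poly (pderiv p) u * D u"
proof -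
  have zero: "D 0 = 0" using assms by (rule is_derivation_zero)
  have add: "D (u + v) = D u + D v" and mult: "D (u * v) = D u * v + u * D v" for u v
    using assms by (auto simp: is_derivation_def)
  show ?thesis
    by (induction p) (simp_all add: zero add mult Polynomial.map_poly_pCons pderiv_pCons algebra_simps)
qed

section \<open>The sum over the common roots\<close>

text \<open>The generic counterpart of evaluating at a point: \<open>x\<close> is sent to the
  transcendental element of the function field.\<close>

definition rat_embed :: "'a::field poly \<Rightarrow> 'a poly fract alg_closure" where
  "rat_embed p = to_ac (to_fract p)"

lemma inj_idom_hom_rat_embed: "inj_idom_hom rat_embed"
  by unfold_locales (simp_all add: rat_embed_def)

abbreviation poly2 :: "'a::comm_ring_1 poly poly \<Rightarrow> 'a \<Rightarrow> 'a \<Rightarrow> 'a" where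
  "poly2 p u v \<equiv> poly (map_poly (\<lambda>q. poly q u) p) v"

lemma comm_ring_hom_poly_at: "comm_ring_hom (\<lambda>q. poly q (u::'a::comm_ring_1))"
  by unfold_locales simp_all

lemma idom_hom_poly_at: "idom_hom (\<lambda>q. poly q (u::'a::idom))"
  by unfold_locales simp_all

text \<open>The situation over one algebraically closed field with one derivation. The identities
  for \<open>d\<close> and \<open>d'\<close> certify that \<open>\<chi>\<close> stays separable and
  \<open>h\<close> nonzero on the curve, generically and above the roots of \<open>F\<close>. The
  hypothesis \<open>simple\<close> asks for a common zero because the theorem assumes
  \<open>F' \<noteq> 0\<close> only at the listed solutions.\<close>

locale curve_pair =
  fixes \<chi> \<theta> g h f1 :: "'a::alg_closed_field poly poly" and f2 F0 F :: "'a poly"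
    and D :: "'a \<Rightarrow> 'a" and n :: nat and y :: "nat \<Rightarrow> 'a poly fract alg_closure"
    and U V d U' V' d'
  assumes monic: "lead_coeff \<chi> = 1" and deg: "degree \<chi> = n" and n_pos: "n > 0"
    and derivation: "is_derivation D" and chi_const: "map_poly (map_poly D) \<chi> = 0"
    and y: "map_poly rat_embed \<chi> = (\<Prod>l=1..n. [:- y l, 1:])"
    and norm: "(\<Prod>l=1..n. poly (map_poly rat_embed \<theta>) (y l)) = rat_embed (F0 * F)"
    and separable: "V * pderiv \<chi> + U * \<chi> = [:d:]" "d \<noteq> 0" "\<And>\<xi>. poly F \<xi> = 0 \<Longrightarrow> poly d \<xi> \<noteq> 0"
    and denominator: "V' * h + U' * \<chi> = [:d':]" "d' \<noteq> 0" "\<And>\<xi>. poly F \<xi> = 0 \<Longrightarrow> poly d' \<xi> \<noteq> 0"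
    and f: "\<chi> dvd g * ([:f2:] * pderiv \<chi>) - f1 * h"
    and nonzero: "f2 \<noteq> 0" "F0 \<noteq> 0" "F \<noteq> 0"
    and no_common_root: "\<And>\<xi>. poly F \<xi> = 0 \<Longrightarrow> poly (f2 * F0) \<xi> \<noteq> 0"
    and simple: "\<And>\<xi> \<eta>. poly F \<xi> = 0 \<Longrightarrow> poly2 \<chi> \<xi> \<eta> = 0 \<Longrightarrow> poly2 \<theta> \<xi> \<eta> = 0 \<Longrightarrow>
      poly (pderiv F) \<xi> \<noteq> 0"
begin

text \<open>Every multiple of \<open>\<chi>\<close> vanishes at \<open>e\<close> in the identities.
  A general \<open>\<phi>\<close> covers both \<open>rat_embed\<close> and evaluation at a root of
  \<open>F\<close>.\<close>

lemma hom_root: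
  assumes "idom_hom \<phi>" "poly (map_poly \<phi> \<chi>) e = (0::'b::field)"
  shows "\<phi> d \<noteq> 0 \<Longrightarrow> poly (map_poly \<phi> (pderiv \<chi>)) e \<noteq> 0"
    and "\<phi> d' \<noteq> 0 \<Longrightarrow> poly (map_poly \<phi> h) e \<noteq> 0"
    and "poly (map_poly \<phi> g) e * (\<phi> f2 * poly (map_poly \<phi> (pderiv \<chi>)) e) =
         poly (map_poly \<phi> f1) e * poly (map_poly \<phi> h) e"
proof -
  interpret idom_hom \<phi> by fact
  interpret mp: map_poly_comm_ring_hom \<phi> ..
  have "poly (map_poly \<phi> (V * pderiv \<chi> + U * \<chi>)) e = \<phi> d"
    unfolding separable(1) by (simp add: Polynomial.map_poly_pCons)
  thus "\<phi> d \<noteq> 0 \<Longrightarrow> poly (map_poly \<phi> (pderiv \<chi>)) e \<noteq> 0"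
    using assms(2) by (auto simp: mp.hom_add mp.hom_mult)
  have "poly (map_poly \<phi> (V' * h + U' * \<chi>)) e = \<phi> d'"
    unfolding denominator(1) by (simp add: Polynomial.map_poly_pCons)
  thus "\<phi> d' \<noteq> 0 \<Longrightarrow> poly (map_poly \<phi> h) e \<noteq> 0"
    using assms(2) by (auto simp: mp.hom_add mp.hom_mult)
  obtain s where "g * ([:f2:] * pderiv \<chi>) - f1 * h = \<chi> * s" using f ..
  hence "poly (map_poly \<phi> (g * ([:f2:] * pderiv \<chi>) - f1 * h)) e = 0"
    using assms(2) by (simp add: mp.hom_mult)
  thus "poly (map_poly \<phi> g) e * (\<phi> f2 * poly (map_poly \<phi> (pderiv \<chi>)) e) =
         poly (map_poly \<phi> f1) e * poly (map_poly \<phi> h) e"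
    by (simp add: mp.hom_mult mp.hom_minus Polynomial.map_poly_pCons del: mult_pCons_left)
qed

lemma card_hom_roots:
  fixes \<phi> :: "'a poly \<Rightarrow> 'b::alg_closed_field"
  assumes "idom_hom \<phi>" "\<phi> d \<noteq> 0"
  shows "card {z. poly (map_poly \<phi> \<chi>) z = 0} = degree \<chi>"
proof -
  interpret idom_hom \<phi> by fact
  have "degree (map_poly \<phi> \<chi>) = degree \<chi>"
    by (rule degree_map_poly_monic[OF monic]) simp_all
  moreover from this have "map_poly \<phi> \<chi> \<noteq> 0"
    using deg n_pos by auto
  hence "card {z. poly (map_poly \<phi> \<chi>) z = 0} = degree (map_poly \<phi> \<chi>)"
    using hom_root(1)[OF assms(1)] assms(2) by (intro card_roots_eq_degree) (auto simp flip: map_poly_pderiv)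
  ultimately show ?thesis by simp
qed

sublocale emb: inj_idom_hom rat_embed
  by (rule inj_idom_hom_rat_embed)

sublocale embp: map_poly_inj_idom_hom rat_embed ..

lemma roots_y: "{z. poly (map_poly rat_embed \<chi>) z = 0} = y ` {1..n}"
  unfolding y by (auto simp: poly_prod)

text \<open>The image of \<open>y\<close> is the root set of a separable polynomial of degree
  \<open>n\<close>, so it has \<open>n\<close> elements.\<close>

lemma inj_y: "inj_on y {1..n}"
  using card_hom_roots[OF emb.idom_hom_axioms] separable(2) deg
  by (intro eq_card_imp_inj_on) (simp_all add: roots_y)

text \<open>Both sides have the same image, the product of \<open>\<theta>\<close> over the
  conjugates, under the injective \<open>rat_embed\<close>.\<close>

lemma poly_norm_eq: "poly_norm \<chi> \<theta> = F0 * F"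
proof -
  have "rat_embed (poly_norm \<chi> \<theta>) = (\<Prod>e\<in>y ` {1..n}. poly (map_poly rat_embed \<theta>) e)"
    using card_hom_roots[OF emb.idom_hom_axioms] separable(2) deg n_pos monic
    by (intro hom_poly_norm_eq_prod emb.comm_ring_hom_axioms) (simp_all add: roots_y)
  also have "\<dots> = rat_embed (F0 * F)"
    unfolding norm[symmetric] by (rule prod.reindex[OF inj_y, unfolded o_def])
  finally show ?thesis by (simp only: emb.eq_iff)
qed

text \<open>One choice of the \<open>Q\<close> with \<open>Q \<theta>\<close> congruent to
  \<open>F0 F\<close> modulo \<open>\<chi>\<close>; at a root of \<open>\<chi>\<close> where
  \<open>\<theta>\<close> is nonzero its value is \<open>F0 F / \<theta>\<close>.\<close>

definition cofactor_poly :: "'a poly poly" where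
  "cofactor_poly = (SOME Q. \<exists>P. Q * \<theta> + P * \<chi> = [:F0 * F:])"

lemma cofactor_poly: obtains P where "cofactor_poly * \<theta> + P * \<chi> = [:F0 * F:]"
proof -
  have "\<exists>Q P. Q * \<theta> + P * \<chi> = [:F0 * F:]"
    using poly_norm_combination[OF monic, of \<theta>] n_pos deg unfolding poly_norm_eq by simp
  hence "\<exists>P. cofactor_poly * \<theta> + P * \<chi> = [:F0 * F:]"
    unfolding cofactor_poly_def by (rule someI_ex)
  thus ?thesis using that by blast
qed

abbreviation "\<delta>\<theta> \<equiv> map_poly (map_poly D) \<theta>"

text \<open>The polynomial \<open>T\<close> in \<open>x\<close> that the Euler-Lagrange formula
  yields for the sum of \<open>f1 \<delta>\<theta> Q / \<chi>'\<close> over the roots of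
  \<open>\<chi>\<close>.\<close>

definition numerator :: "'a poly" where
  "numerator = coeff (pseudo_mod (f1 * \<delta>\<theta> * cofactor_poly) \<chi>) (n - 1)"

lemma hom_cofactor:
  assumes "idom_hom \<phi>" "poly (map_poly \<phi> \<chi>) e = (0::'b::field)"
  shows "poly (map_poly \<phi> cofactor_poly) e * poly (map_poly \<phi> \<theta>) e = \<phi> (F0 * F)"
proof -
  interpret idom_hom \<phi> by fact
  interpret mp: map_poly_comm_ring_hom \<phi> ..
  obtain P where P: "cofactor_poly * \<theta> + P * \<chi> = [:F0 * F:]" by (rule cofactor_poly)
  have "poly (map_poly \<phi> (cofactor_poly * \<theta> + P * \<chi>)) e = \<phi> (F0 * F)"
    unfolding P by (simp add: Polynomial.map_poly_pCons)
  thus ?thesis using assms(2) by (simp add: mp.hom_add mp.hom_mult)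
qed

lemma hom_numerator:
  fixes \<phi> :: "'a poly \<Rightarrow> 'b::alg_closed_field"
  assumes "idom_hom \<phi>" "\<phi> d \<noteq> 0"
  shows "\<phi> numerator = (\<Sum>e | poly (map_poly \<phi> \<chi>) e = 0.
    poly (map_poly \<phi> f1) e * poly (map_poly \<phi> \<delta>\<theta>) e * poly (map_poly \<phi> cofactor_poly) e /
    poly (map_poly \<phi> (pderiv \<chi>)) e)"
proof -
  interpret idom_hom \<phi> by fact
  interpret mp: map_poly_comm_ring_hom \<phi> ..
  show ?thesis
    using sum_over_simple_roots_hom[OF assms(1) monic refl card_hom_roots[OF assms], of "f1 * \<delta>\<theta> * cofactor_poly"]
      n_pos deg by (simp add: numerator_def mp.hom_mult)
qed

lemma sum_over_conjugates:
  "(\<Sum>l=1..n. poly (map_poly rat_embed g) (y l) / poly (map_poly rat_embed h) (y l) *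
      (poly (map_poly rat_embed \<delta>\<theta>) (y l) / poly (map_poly rat_embed \<theta>) (y l))) =
    to_ac (Fract numerator (f2 * F0 * F))"
proof -
  note hom = emb.idom_hom_axioms
  let ?ev = "\<lambda>p. poly (map_poly rat_embed p)"
  have "(\<Sum>l=1..n. ?ev g (y l) / ?ev h (y l) * (?ev \<delta>\<theta> (y l) / ?ev \<theta> (y l))) =
      (\<Sum>l=1..n. ?ev f1 (y l) * ?ev \<delta>\<theta> (y l) * ?ev cofactor_poly (y l) / ?ev (pderiv \<chi>) (y l) /
        rat_embed (f2 * F0 * F))"
  proof (intro sum.cong refl)
    fix l assume "l \<in> {1..n}"
    hence root: "?ev \<chi> (y l) = 0" using roots_y by blast
    have nz: "rat_embed d \<noteq> 0" "rat_embed d' \<noteq> 0" "rat_embed f2 \<noteq> 0" "rat_embed (F0 * F) \<noteq> 0"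
      using separable denominator nonzero by auto
    note h = hom_root(1)[OF hom root nz(1)] hom_root(2)[OF hom root nz(2)] hom_root(3)[OF hom root]
    note c = hom_cofactor[OF hom root]
    have "?ev g (y l) / ?ev h (y l) = ?ev f1 (y l) / (rat_embed f2 * ?ev (pderiv \<chi>) (y l))"
      using h nz(3) by (simp add: frac_eq_eq mult.commute)
    \<comment> \<open>By \<open>c\<close>, \<open>Q\<close> times \<open>\<theta>\<close> is the
      nonzero image of \<open>F0 F\<close>, so \<open>\<theta>\<close> is nonzero at
      \<open>y l\<close> and \<open>1/\<theta>\<close> equals \<open>Q/(F0 F)\<close> there.\<close>
    moreover have "?ev \<delta>\<theta> (y l) / ?ev \<theta> (y l) = ?ev \<delta>\<theta> (y l) * ?ev cofactor_poly (y l) / rat_embed (F0 * F)"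
      using c nz(4) by (simp add: frac_eq_eq flip: c)
    ultimately show "?ev g (y l) / ?ev h (y l) * (?ev \<delta>\<theta> (y l) / ?ev \<theta> (y l)) =
        ?ev f1 (y l) * ?ev \<delta>\<theta> (y l) * ?ev cofactor_poly (y l) / ?ev (pderiv \<chi>) (y l) /
        rat_embed (f2 * F0 * F)"
      by (simp add: emb.hom_mult divide_inverse ac_simps)
  qed
  also have "\<dots> = (\<Sum>e\<in>y ` {1..n}. ?ev f1 e * ?ev \<delta>\<theta> e * ?ev cofactor_poly e / ?ev (pderiv \<chi>) e) /
      rat_embed (f2 * F0 * F)"
    by (subst sum.reindex[OF inj_y]) (simp add: sum_divide_distrib)
  also have "\<dots> = rat_embed numerator / rat_embed (f2 * F0 * F)"
    using hom_numerator[OF hom] separable(2) by (simp add: roots_y)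
  also have "\<dots> = to_ac (Fract numerator (f2 * F0 * F))"
    using nonzero by (simp add: rat_embed_def Fract_conv_to_fract)
  finally show ?thesis .
qed

text \<open>
  Applying \<open>D\<close> to \<open>F0 \<xi> F \<xi> = 0\<close> yields \<open>\<delta>(F0 F)(\<xi>) = - F0 \<xi> F' \<xi> D \<xi>\<close>; applying it to the
  coefficients of \<open>Q \<theta> + P \<chi> = F0 F\<close> yields \<open>\<delta>(F0 F)(\<xi>) = Q \<delta>\<theta>\<close> at a common zero of \<open>\<chi>\<close>, \<open>\<theta>\<close>.
\<close>

lemma cofactor_times_delta:
  assumes "poly F \<xi> = 0" "poly2 \<chi> \<xi> \<eta> = 0" "poly2 \<theta> \<xi> \<eta> = 0"
  shows "poly2 \<delta>\<theta> \<xi> \<eta> * poly2 cofactor_poly \<xi> \<eta> = - (poly F0 \<xi> * poly (pderiv F) \<xi> * D \<xi>)"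
proof -
  interpret ev: idom_hom "\<lambda>q. poly q \<xi>" by (rule idom_hom_poly_at)
  interpret mp: map_poly_comm_ring_hom "\<lambda>q. poly q \<xi>" ..
  let ?\<delta> = "map_poly (map_poly D)"
  have "is_derivation ?\<delta>"
    by (intro is_derivation_map_poly derivation)
  hence add: "?\<delta> (p + q) = ?\<delta> p + ?\<delta> q" and mult: "?\<delta> (p * q) = ?\<delta> p * q + p * ?\<delta> q" for p q
    by (auto simp: is_derivation_def)
  obtain P where P: "cofactor_poly * \<theta> + P * \<chi> = [:F0 * F:]" by (rule cofactor_poly)
  have "poly2 (?\<delta> (cofactor_poly * \<theta> + P * \<chi>)) \<xi> \<eta> = poly (map_poly D (F0 * F)) \<xi>"
    unfolding P using is_derivation_zero[OF derivation] by (simp add: Polynomial.map_poly_pCons)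
  \<comment> \<open>In the product rule the derivatives of \<open>Q\<close> and \<open>P\<close> are
    multiplied by \<open>\<theta>\<close> and \<open>\<chi>\<close>, which vanish here, and
    \<open>\<chi>\<close> has constant coefficients.\<close>
  hence 1: "poly2 cofactor_poly \<xi> \<eta> * poly2 \<delta>\<theta> \<xi> \<eta> = poly (map_poly D (F0 * F)) \<xi>"
    using assms by (simp add: add mult mp.hom_add mp.hom_mult chi_const)
  have "D (poly (F0 * F) \<xi>) = 0"
    using assms(1) is_derivation_zero[OF derivation] by simp
  hence "poly (map_poly D (F0 * F)) \<xi> = - (poly (pderiv (F0 * F)) \<xi> * D \<xi>)"
    unfolding is_derivation_poly[OF derivation] by (simp add: eq_neg_iff_add_eq_0)
  also have "poly (pderiv (F0 * F)) \<xi> = poly F0 \<xi> * poly (pderiv F) \<xi>"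
    using assms(1) by (simp add: pderiv_mult)
  finally show ?thesis using 1 by (simp add: mult.commute)
qed

text \<open>The norm specialises to the product of \<open>\<theta>\<close> over the roots of
  \<open>\<chi>\<close> above \<open>\<xi>\<close>, and it vanishes at \<open>\<xi>\<close>. This
  makes \<open>simple\<close> applicable at every root of \<open>F\<close>.\<close>

lemma common_root_exists:
  assumes "poly F \<xi> = 0"
  shows "\<exists>\<eta>. poly2 \<chi> \<xi> \<eta> = 0 \<and> poly2 \<theta> \<xi> \<eta> = 0"
proof -
  have card: "card {\<eta>. poly2 \<chi> \<xi> \<eta> = 0} = degree \<chi>"
    using card_hom_roots[OF idom_hom_poly_at] separable(3)[OF assms] .
  have "poly (poly_norm \<chi> \<theta>) \<xi> = (\<Prod>\<eta> | poly2 \<chi> \<xi> \<eta> = 0. poly2 \<theta> \<xi> \<eta>)"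
    using n_pos deg by (intro hom_poly_norm_eq_prod comm_ring_hom_poly_at monic refl card) simp
  moreover have "poly (poly_norm \<chi> \<theta>) \<xi> = 0"
    using assms by (simp add: poly_norm_eq)
  moreover have "finite {\<eta>. poly2 \<chi> \<xi> \<eta> = 0}"
    using card n_pos deg by (metis card_ge_0_finite)
  ultimately show ?thesis by auto
qed

text \<open>The pole at \<open>\<xi>\<close> is simple; expanding its residue over the roots above
  \<open>\<xi>\<close>, the factor \<open>F0 F'\<close> from \<open>cofactor_times_delta\<close>
  cancels against the denominator, and the sign comes from the same lemma.\<close>

lemma residue_at_root:
  assumes "poly F \<xi> = 0"
  shows "(\<Sum>\<eta> | poly2 \<chi> \<xi> \<eta> = 0 \<and> poly2 \<theta> \<xi> \<eta> = 0. poly2 g \<xi> \<eta> / poly2 h \<xi> \<eta> * D \<xi>) =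
    - ratfun_res \<xi> (Fract numerator (f2 * F0 * F))"
proof -
  note hom = idom_hom_poly_at[of \<xi>]
  let ?E = "{\<eta>. poly2 \<chi> \<xi> \<eta> = 0}"
  have fin: "finite ?E"
    using card_hom_roots[OF hom separable(3)[OF assms]] n_pos deg by (metis card_ge_0_finite)
  define c where "c = poly (f2 * F0) \<xi> * poly (pderiv F) \<xi>"
  have F': "poly (pderiv F) \<xi> \<noteq> 0"
    using common_root_exists[OF assms] simple[OF assms] by blast
  hence c: "c \<noteq> 0" using no_common_root[OF assms] by (simp add: c_def)
  have "poly (pderiv (f2 * F0 * F)) \<xi> = c"
    using assms by (simp add: pderiv_mult c_def)
  hence "ratfun_res \<xi> (Fract numerator (f2 * F0 * F)) = poly numerator \<xi> / c"
    using assms c by (subst ratfun_res_simple_root) auto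
  also have "\<dots> = (\<Sum>\<eta>\<in>?E. poly2 f1 \<xi> \<eta> * poly2 \<delta>\<theta> \<xi> \<eta> * poly2 cofactor_poly \<xi> \<eta> /
      poly2 (pderiv \<chi>) \<xi> \<eta> / c)"
    unfolding hom_numerator[OF hom separable(3)[OF assms]] sum_divide_distrib ..
  also have "\<dots> = (\<Sum>\<eta> | poly2 \<chi> \<xi> \<eta> = 0 \<and> poly2 \<theta> \<xi> \<eta> = 0.
      poly2 f1 \<xi> \<eta> * poly2 \<delta>\<theta> \<xi> \<eta> * poly2 cofactor_poly \<xi> \<eta> / poly2 (pderiv \<chi>) \<xi> \<eta> / c)"
  \<comment> \<open>Where \<open>\<theta>\<close> is nonzero, \<open>Q \<theta> = F0 F = 0\<close>
    forces \<open>Q = 0\<close>.\<close>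
  proof (rule sum.mono_neutral_right[OF fin])
    show "\<forall>\<eta>\<in>?E - {\<eta>. poly2 \<chi> \<xi> \<eta> = 0 \<and> poly2 \<theta> \<xi> \<eta> = 0}.
        poly2 f1 \<xi> \<eta> * poly2 \<delta>\<theta> \<xi> \<eta> * poly2 cofactor_poly \<xi> \<eta> / poly2 (pderiv \<chi>) \<xi> \<eta> / c = 0"
    proof
      fix \<eta> assume "\<eta> \<in> ?E - {\<eta>. poly2 \<chi> \<xi> \<eta> = 0 \<and> poly2 \<theta> \<xi> \<eta> = 0}"
      hence "poly2 \<chi> \<xi> \<eta> = 0" "poly2 \<theta> \<xi> \<eta> \<noteq> 0" by auto
      with hom_cofactor[OF hom this(1)] assms have "poly2 cofactor_poly \<xi> \<eta> = 0" by simp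
      thus "poly2 f1 \<xi> \<eta> * poly2 \<delta>\<theta> \<xi> \<eta> * poly2 cofactor_poly \<xi> \<eta> / poly2 (pderiv \<chi>) \<xi> \<eta> / c = 0"
        by simp
    qed
  qed auto
  also have "\<dots> = (\<Sum>\<eta> | poly2 \<chi> \<xi> \<eta> = 0 \<and> poly2 \<theta> \<xi> \<eta> = 0. - (poly2 g \<xi> \<eta> / poly2 h \<xi> \<eta> * D \<xi>))"
  proof (intro sum.cong refl)
    fix \<eta> assume "\<eta> \<in> {\<eta>. poly2 \<chi> \<xi> \<eta> = 0 \<and> poly2 \<theta> \<xi> \<eta> = 0}"
    hence \<eta>: "poly2 \<chi> \<xi> \<eta> = 0" "poly2 \<theta> \<xi> \<eta> = 0" by auto
    note h = hom_root(1)[OF hom \<eta>(1) separable(3)[OF assms]]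
      hom_root(2)[OF hom \<eta>(1) denominator(3)[OF assms]] hom_root(3)[OF hom \<eta>(1)]
    have nz: "poly f2 \<xi> \<noteq> 0" "poly F0 \<xi> \<noteq> 0"
      using no_common_root[OF assms] by auto
    have "poly2 g \<xi> \<eta> / poly2 h \<xi> \<eta> = poly2 f1 \<xi> \<eta> / (poly f2 \<xi> * poly2 (pderiv \<chi>) \<xi> \<eta>)"
      using h nz by (simp add: frac_eq_eq mult.commute)
    moreover have "poly2 f1 \<xi> \<eta> * poly2 \<delta>\<theta> \<xi> \<eta> * poly2 cofactor_poly \<xi> \<eta> / poly2 (pderiv \<chi>) \<xi> \<eta> / c =
        - (poly2 f1 \<xi> \<eta> * (poly F0 \<xi> * poly (pderiv F) \<xi> * D \<xi>) / poly2 (pderiv \<chi>) \<xi> \<eta> / c)"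
      using cofactor_times_delta[OF assms \<eta>] by (simp add: mult.assoc)
    ultimately show "poly2 f1 \<xi> \<eta> * poly2 \<delta>\<theta> \<xi> \<eta> * poly2 cofactor_poly \<xi> \<eta> / poly2 (pderiv \<chi>) \<xi> \<eta> / c =
        - (poly2 g \<xi> \<eta> / poly2 h \<xi> \<eta> * D \<xi>)"
      using nz F' by (simp add: c_def)
  qed
  finally show ?thesis by (simp add: sum_negf)
qed

text \<open>Grouping the common zeros by \<open>\<xi>\<close> gives minus the residues at the roots
  of \<open>F\<close>; these are disjoint from the roots of \<open>f2 F0\<close>, and the residue
  theorem supplies the rest.\<close>

lemma sum_over_common_roots:
  "(\<Sum>(\<xi>, \<eta>) | poly F \<xi> = 0 \<and> poly2 \<chi> \<xi> \<eta> = 0 \<and> poly2 \<theta> \<xi> \<eta> = 0.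
      poly2 g \<xi> \<eta> / poly2 h \<xi> \<eta> * D \<xi>) =
   (\<Sum>b | poly (f2 * F0) b = 0. ratfun_res b (Fract numerator (f2 * F0 * F))) -
     ratfun_Pi (Fract numerator (f2 * F0 * F))"
proof -
  let ?S = "Fract numerator (f2 * F0 * F)"
  let ?E = "\<lambda>\<xi>. {\<eta>. poly2 \<chi> \<xi> \<eta> = 0 \<and> poly2 \<theta> \<xi> \<eta> = 0}"
  have fin: "finite {\<xi>. poly F \<xi> = 0}" "finite {b. poly (f2 * F0) b = 0}"
    using nonzero by (auto intro!: poly_roots_finite simp del: poly_mult)
  have finE: "finite (?E \<xi>)" if "poly F \<xi> = 0" for \<xi>
    using card_hom_roots[OF idom_hom_poly_at separable(3)[OF that]] n_pos deg
    by (intro finite_subset[of "?E \<xi>" "{\<eta>. poly2 \<chi> \<xi> \<eta> = 0}"]) (auto intro: card_ge_0_finite)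
  have "{(\<xi>, \<eta>). poly F \<xi> = 0 \<and> poly2 \<chi> \<xi> \<eta> = 0 \<and> poly2 \<theta> \<xi> \<eta> = 0} = Sigma {\<xi>. poly F \<xi> = 0} ?E"
    by auto
  hence "(\<Sum>(\<xi>, \<eta>) | poly F \<xi> = 0 \<and> poly2 \<chi> \<xi> \<eta> = 0 \<and> poly2 \<theta> \<xi> \<eta> = 0.
      poly2 g \<xi> \<eta> / poly2 h \<xi> \<eta> * D \<xi>) =
      (\<Sum>\<xi> | poly F \<xi> = 0. \<Sum>\<eta>\<in>?E \<xi>. poly2 g \<xi> \<eta> / poly2 h \<xi> \<eta> * D \<xi>)"
    using fin(1) finE by (simp add: sum.Sigma)
  also have "\<dots> = - (\<Sum>\<xi> | poly F \<xi> = 0. ratfun_res \<xi> ?S)"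
    using residue_at_root by (simp add: sum_negf)
  finally have *: "(\<Sum>(\<xi>, \<eta>) | poly F \<xi> = 0 \<and> poly2 \<chi> \<xi> \<eta> = 0 \<and> poly2 \<theta> \<xi> \<eta> = 0.
      poly2 g \<xi> \<eta> / poly2 h \<xi> \<eta> * D \<xi>) = - (\<Sum>\<xi> | poly F \<xi> = 0. ratfun_res \<xi> ?S)" .
  have "{b. poly (f2 * F0 * F) b = 0} = {b. poly (f2 * F0) b = 0} \<union> {\<xi>. poly F \<xi> = 0}"
    by auto
  moreover have "{b. poly (f2 * F0) b = 0} \<inter> {\<xi>. poly F \<xi> = 0} = {}"
    using no_common_root by blast
  ultimately have "ratfun_Pi ?S = (\<Sum>b | poly (f2 * F0) b = 0. ratfun_res b ?S) + (\<Sum>\<xi> | poly F \<xi> = 0. ratfun_res \<xi> ?S)"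
    using sum_ratfun_res_eq_Pi[of "f2 * F0 * F" numerator] nonzero fin
    by (simp add: sum.union_disjoint)
  thus ?thesis unfolding * by simp
qed

end

section \<open>The ambient fields\<close>

lemma inj_idom_hom_param_to_alg: "inj_idom_hom param_to_alg"
  by unfold_locales (simp_all add: param_to_alg_def flip: to_fract_def)

interpretation param: inj_idom_hom param_to_alg
  by (rule inj_idom_hom_param_to_alg)

lemma inj_idom_hom_param_const: "inj_idom_hom param_const"
proof unfold_locales
  show "x = 0" if "param_const x = 0" for x
    using that unfolding param_const_def by (metis lookup_single_eq lookup_zero)
qed (simp_all add: param_const_def single_add mult_single flip: single_one)

interpretation const: inj_idom_hom const_to_alg
proof -
  interpret c: inj_idom_hom param_const by (rule inj_idom_hom_param_const)
  show "inj_idom_hom const_to_alg"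
    by unfold_locales (simp_all add: const_to_alg_def c.hom_add c.hom_mult param.hom_add param.hom_mult)
qed

interpretation constp: map_poly_inj_idom_hom const_to_alg ..
interpretation constpp: map_poly_inj_idom_hom "map_poly const_to_alg" ..

lemma lookup_mult_param_const:
  "Poly_Mapping.lookup (p * param_const c) m = Poly_Mapping.lookup p m * c"
proof -
  have p: "p = (\<Sum>k\<in>Poly_Mapping.keys p. Poly_Mapping.single k (Poly_Mapping.lookup p k))"
    by (rule poly_mapping_eqI) (simp add: lookup_sum lookup_single when_def in_keys_iff)
  have "p * param_const c = (\<Sum>k\<in>Poly_Mapping.keys p. Poly_Mapping.single k (Poly_Mapping.lookup p k * c))"
    by (subst p) (simp add: sum_distrib_right param_const_def mult_single)
  also have "Poly_Mapping.lookup \<dots> m = Poly_Mapping.lookup p m * c"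
    by (simp add: lookup_sum lookup_single when_def in_keys_iff)
  finally show ?thesis .
qed

text \<open>Translates evaluation at the generic \<open>x\<close> into \<open>rat_embed\<close>, the
  form in which the results on \<open>curve_pair\<close> are stated.\<close>

lemma eval_poly1_algfun:
  assumes "h 0 = 0"
  shows "eval_poly1 (\<lambda>c. alg_to_algfun (h c)) q X_algfun = rat_embed (map_poly h q)"
proof -
  interpret emb: inj_idom_hom "rat_embed :: param_alg poly \<Rightarrow> algfun" by (rule inj_idom_hom_rat_embed)
  have emb: "alg_to_algfun z = rat_embed [:z:]" "X_algfun = rat_embed [:0, 1:]" for z
    by (simp_all add: rat_embed_def alg_to_algfun_def X_algfun_def to_fract_def)
  show ?thesis
  proof (induction q)
    case (pCons a q)
    have "rat_embed (pCons (h a) (map_poly h q)) = rat_embed ([:h a:] + [:0, 1:] * map_poly h q)"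
      by simp
    also have "\<dots> = rat_embed [:h a:] + rat_embed [:0, 1:] * rat_embed (map_poly h q)"
      by (simp only: emb.hom_add emb.hom_mult)
    finally show ?case
      using pCons assms by (simp add: eval_poly1_def Polynomial.map_poly_pCons emb)
  qed (simp add: eval_poly1_def)
qed

lemma eval_poly2_algfun:
  assumes "h 0 = 0"
  shows "eval_poly2 (\<lambda>c. alg_to_algfun (h c)) p X_algfun v =
    poly (map_poly rat_embed (map_poly (map_poly h) p)) v"
proof -
  interpret emb: inj_idom_hom "rat_embed :: param_alg poly \<Rightarrow> algfun" by (rule inj_idom_hom_rat_embed)
  show ?thesis
    unfolding eval_poly2_def eval_poly1_algfun[where h = h, OF assms]
    by (subst map_poly_map_poly) (simp_all add: o_def)
qed

lemma eval_poly2_poly2: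
  assumes "h 0 = 0"
  shows "eval_poly2 h p u v = poly2 (map_poly (map_poly h) p) u v"
  unfolding eval_poly2_def eval_poly1_def
  by (subst map_poly_map_poly) (simp_all add: o_def)

lemmas eval_const =
  eval_poly1_algfun[of const_to_alg, folded const_to_algfun_def, OF const.hom_zero]
  eval_poly2_algfun[of const_to_alg, folded const_to_algfun_def, OF const.hom_zero]
  eval_poly2_poly2[of const_to_alg, OF const.hom_zero]

lemmas eval_param =
  eval_poly1_algfun[of param_to_alg, folded param_to_algfun_def, OF param.hom_zero]
  eval_poly2_algfun[of param_to_alg, folded param_to_algfun_def, OF param.hom_zero]
  eval_poly2_poly2[of param_to_alg, OF param.hom_zero]

section \<open>Roots that are complex constants\<close>

text \<open>The factorisation over the complex numbers is carried to the larger field, which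
  therefore contributes no further roots.\<close>

lemma root_const_poly:
  fixes p :: "complex poly"
  assumes "p \<noteq> 0" "poly (map_poly const_to_alg p) z = 0"
  obtains c where "z = const_to_alg c" "poly p c = 0"
proof -
  obtain A where A: "p = smult (lead_coeff p) (\<Prod>x\<in>#A. [:- x, 1:])"
    using alg_closed_imp_factorization[OF assms(1)] by blast
  have map: "map_poly const_to_alg (\<Prod>x\<in>#A. [:- x, 1:]) = (\<Prod>x\<in>#A. [:- const_to_alg x, 1:])"
    by (induction A) (simp_all add: constp.hom_mult const.hom_uminus Polynomial.map_poly_pCons del: mult_pCons_left)
  have "map_poly const_to_alg p = smult (const_to_alg (lead_coeff p)) (\<Prod>x\<in>#A. [:- const_to_alg x, 1:])"
    by (subst A) (simp add: const.map_poly_hom_smult map)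
  with assms obtain c where c: "c \<in># A" "z = const_to_alg c"
    by (auto simp: poly_prod_mset prod_mset_zero_iff)
  have "poly p c = 0"
    by (subst A) (use c in \<open>auto simp: poly_prod_mset prod_mset_zero_iff\<close>)
  with c(2) that show thesis by blast
qed

text \<open>Expanding \<open>F(c) = 0\<close> in monomials of the parameters, \<open>c\<close> is a
  root of the coefficient polynomial of every monomial, each with coefficients in
  \<open>K\<close>.\<close>

lemma alg_over_const_root:
  assumes F: "F \<noteq> 0" "coeffs1_in (param_ring K J) F" and K: "0 \<in> K"
    and root: "eval_poly1 param_to_alg F (const_to_alg c) = 0"
  shows "alg_over K (const_to_alg c)"
proof -
  have "eval_poly1 param_to_alg F (const_to_alg c) = param_to_alg (poly F (param_const c))"
    by (simp add: eval_poly1_def const_to_alg_def param.poly_map_poly)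
  with root have root': "poly F (param_const c) = 0" by simp
  have lookup: "Poly_Mapping.lookup (poly p (param_const c)) m =
      poly (map_poly (\<lambda>q. Poly_Mapping.lookup q m) p) c" for p m
    by (induction p) (simp_all add: Polynomial.map_poly_pCons lookup_add mult.commute[of "param_const c"]
        lookup_mult_param_const)
  \<comment> \<open>A monomial of the leading coefficient ensures that the extracted polynomial is
    nonzero.\<close>
  obtain m where m: "Poly_Mapping.lookup (lead_coeff F) m \<noteq> 0"
    using F(1) by (metis leading_coeff_0_iff poly_mapping_eqI lookup_zero)
  define p where "p = map_poly (\<lambda>q. Poly_Mapping.lookup q m) F"
  have "poly p c = 0"
    unfolding p_def lookup[symmetric] root' by simp
  hence "eval_poly1 const_to_alg p (const_to_alg c) = 0"
    by (simp add: eval_poly1_def const.poly_map_poly)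
  moreover have "coeff p (degree F) \<noteq> 0"
    using m by (simp add: p_def coeff_map_poly)
  hence "p \<noteq> 0" by auto
  moreover have "coeffs1_in K p"
    using F(2) K by (auto simp: p_def coeffs1_in_def coeff_map_poly param_ring_def)
  ultimately show ?thesis unfolding alg_over_def by blast
qed

lemma param_pderiv_const: "param_pderiv k (param_const c) = 0"
  unfolding param_pderiv_def param_const_def
  by (intro sum.neutral) (auto simp: keys_single split: if_splits)

section \<open>Transfer of the given data to the closure of the parameter field\<close>

theorem theorem3p9:
  fixes K :: "complex set"
    and \<chi> g h f1 :: "complex poly poly" and f2 F0 :: "complex poly"
    and I J :: "nat set" and a :: "nat \<Rightarrow> param_poly"
    and \<theta> :: "param_poly poly poly" and F :: "param_poly poly"
    and n \<mu> \<alpha> :: nat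
    and y :: "nat \<Rightarrow> algfun" and xs ys :: "nat \<Rightarrow> param_alg"
    and D :: "nat \<Rightarrow> param_alg \<Rightarrow> param_alg" and \<beta> :: "nat \<Rightarrow> complex"
  assumes K: "computable_subfield K"
    and chi: "coeffs2_in K \<chi>" "lead_coeff \<chi> = 1" "degree \<chi> = n" "irreducible \<chi>"
    and y: "map_poly (\<lambda>q. eval_poly1 const_to_algfun q X_algfun) \<chi> = (\<Prod>l=1..n. [:- y l, 1:])"
    \<comment> \<open>the parameters\<close>
    and params: "finite I" "J \<subseteq> I" "\<And>k. k \<in> J \<Longrightarrow> a k = param_var k"
      "\<And>i. i \<in> I - J \<Longrightarrow> \<exists>c0\<in>K. \<exists>c. (\<forall>k\<in>J. c k \<in> K) \<and>
         a i = param_const c0 + (\<Sum>k\<in>J. param_const (c k) * a k)"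
    and theta: "\<theta> \<noteq> 0" "degree \<theta> < n" "coeffs2_in (a ` I \<union> param_const ` K) \<theta>"
    and D: "\<And>k. k \<in> J \<Longrightarrow> extends_param_deriv k (D k)"
    \<comment> \<open>the factorisation \<open>r = F0 F\<close>\<close>
    and F0_F: "coeffs1_in K F0" "coeffs1_in (param_ring K J) F"
      "(\<Prod>l=1..n. eval_poly2 param_to_algfun \<theta> X_algfun (y l)) =
         eval_poly1 const_to_algfun F0 X_algfun * eval_poly1 param_to_algfun F X_algfun"
      "\<And>z. eval_poly1 const_to_alg F0 z = 0 \<Longrightarrow> alg_over K z"
      "\<And>z. eval_poly1 param_to_alg F z = 0 \<Longrightarrow> \<not> alg_over K z"
    \<comment> \<open>the solutions with transcendental \<open>x\<close>-coordinate\<close>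
    and sols: "bij_betw (\<lambda>i. (xs i, ys i)) {1..\<mu>}
      {(u, v). eval_poly2 const_to_alg \<chi> u v = 0 \<and> eval_poly2 param_to_alg \<theta> u v = 0 \<and> \<not> alg_over K u}"
    \<comment> \<open>the rational function \<open>f = g/h\<close>, equal to \<open>f1/(f2 \<chi>')\<close> modulo \<open>\<chi>\<close>\<close>
    and f: "coeffs2_in K g" "coeffs2_in K h" "\<not> \<chi> dvd h"
      "coeffs2_in K f1" "coeffs1_in K f2" "f2 \<noteq> 0" "\<chi> dvd g * ([:f2:] * pderiv \<chi>) - f1 * h"
    and beta: "bij_betw \<beta> {1..\<alpha>} {b. poly (f2 * F0) b = 0}"
    and squarefree: "\<And>i. i \<in> {1..\<mu>} \<Longrightarrow> eval_poly1 param_to_alg (pderiv F) (xs i) \<noteq> 0"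
  shows "\<forall>k\<in>J.
    (\<Sum>i=1..\<mu>. eval_poly2 const_to_alg g (xs i) (ys i) / eval_poly2 const_to_alg h (xs i) (ys i) *
       D k (xs i)) =
    (\<Sum>j=1..\<alpha>. ratfun_res (const_to_alg (\<beta> j)) (S_coeff g h \<theta> n y k)) -
    ratfun_Pi (S_coeff g h \<theta> n y k)"
proof
  fix k assume k: "k \<in> J"
  let ?c = "map_poly const_to_alg" and ?cc = "map_poly (map_poly const_to_alg)"
  let ?p = "map_poly param_to_alg" and ?pp = "map_poly (map_poly param_to_alg)"
  have "subring K (ring_of_type_algebra :: complex ring)"
    using K subfieldE(1) unfolding computable_subfield_def by blast
  from subringE(2,3)[OF this] have K01: "0 \<in> K" "1 \<in> K"
    by (simp_all add: ring_of_type_algebra_def)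
  have n: "n > 0" using theta(2) by simp
  \<comment> \<open>Otherwise every complex number would be a root of \<open>f2 * F0\<close>, but
    \<open>\<beta>\<close> enumerates finitely many.\<close>
  have F0: "F0 \<noteq> 0"
  proof
    assume "F0 = 0"
    hence "finite (UNIV :: complex set)"
      using bij_betw_finite[OF beta] by simp
    thus False using infinite_UNIV_char_0 by blast
  qed
  \<comment> \<open>Otherwise 0 would be a root of \<open>F\<close>, and it is algebraic over
    \<open>K\<close> as the root of \<open>x\<close>.\<close>
  have F: "F \<noteq> 0"
  proof
    assume "F = 0"
    moreover have "alg_over K 0"
      unfolding alg_over_def
      by (intro exI[of _ "[:0, 1:]"]) (use K01 in \<open>auto simp: coeffs1_in_def eval_poly1_def
          Polynomial.map_poly_pCons coeff_pCons split: nat.splits\<close>)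
    ultimately show False using F0_F(5)[of 0] by (simp add: eval_poly1_def)
  qed
  \<comment> \<open>A common root would be a complex constant, hence algebraic over \<open>K\<close>
    as a root of \<open>F\<close>. This is used for \<open>d\<close>, \<open>d'\<close>,
    \<open>f2\<close> and \<open>F0\<close>.\<close>
  have F_roots: "poly (?c p) \<xi> \<noteq> 0" if \<xi>: "poly (?p F) \<xi> = 0" and p: "p \<noteq> 0" for p \<xi>
  proof
    assume "poly (?c p) \<xi> = 0"
    then obtain c where c: "\<xi> = const_to_alg c" using root_const_poly[OF p] by blast
    with \<xi> alg_over_const_root[OF F F0_F(2) K01(1), of c] F0_F(5)[of \<xi>] show False
      by (simp add: eval_poly1_def)
  qed
  have der: "is_derivation (D k)" and D_param: "D k (param_to_alg p) = param_to_alg (param_pderiv k p)" for p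
    using D[OF k] by (auto simp: extends_param_deriv_def is_derivation_def)
  have D0: "D k 0 = 0" by (rule is_derivation_zero[OF der])
  have D_const: "D k (const_to_alg c) = 0" for c
    by (simp add: const_to_alg_def D_param param_pderiv_const)
  have "param_to_alg (param_pderiv k 0) = 0"
    using D_param[of 0] D0 by simp
  hence pd0: "param_pderiv k 0 = 0" by simp

  have not_dvd: "\<not> \<chi> dvd pderiv \<chi>"
  proof
    assume "\<chi> dvd pderiv \<chi>"
    moreover have "pderiv \<chi> \<noteq> 0" "degree (pderiv \<chi>) < degree \<chi>"
      using n chi(3) by (simp_all add: pderiv_eq_0_iff degree_pderiv)
    ultimately show False using dvd_imp_degree_le by fastforce
  qed
  obtain U V d where sep: "d \<noteq> 0" "V * pderiv \<chi> + U * \<chi> = [:d:]"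
    using poly_norm_bezout[OF chi(2,4) not_dvd] .
  obtain U' V' d' where den: "d' \<noteq> 0" "V' * h + U' * \<chi> = [:d':]"
    using poly_norm_bezout[OF chi(2,4) f(3)] .

  let ?sols = "{(u, v). eval_poly2 const_to_alg \<chi> u v = 0 \<and> eval_poly2 param_to_alg \<theta> u v = 0 \<and> \<not> alg_over K u}"
  have sols_memI: "(\<xi>, \<eta>) \<in> ?sols"
    if "poly (?p F) \<xi> = 0" "poly2 (?cc \<chi>) \<xi> \<eta> = 0" "poly2 (?pp \<theta>) \<xi> \<eta> = 0" for \<xi> \<eta>
    using that F0_F(5)[of \<xi>] by (simp add: eval_const eval_param eval_poly1_def)

  interpret cp: curve_pair "?cc \<chi>" "?pp \<theta>" "?cc g" "?cc h" "?cc f1" "?c f2" "?c F0" "?p F" "D k" n y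
    "?cc U" "?cc V" "?c d" "?cc U'" "?cc V'" "?c d'"
  proof
    show "lead_coeff (?cc \<chi>) = 1" "degree (?cc \<chi>) = n"
      using chi by simp_all
    show "n > 0" by fact
    show "is_derivation (D k)" by fact
    show "map_poly (map_poly (D k)) (?cc \<chi>) = 0"
      using D0 D_const by (intro poly_eqI) (simp add: coeff_map_poly)
    show "map_poly rat_embed (?cc \<chi>) = (\<Prod>l=1..n. [:- y l, 1:])"
      unfolding y[symmetric] eval_const
      by (subst map_poly_map_poly) (simp_all add: o_def rat_embed_def)
    show "(\<Prod>l=1..n. poly (map_poly rat_embed (?pp \<theta>)) (y l)) = rat_embed (?c F0 * ?p F)"
      using F0_F(3) inj_idom_hom_rat_embed unfolding eval_const eval_param
      by (simp add: rat_embed_def)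
    have "?cc (V * pderiv \<chi> + U * \<chi>) = ?cc [:d:]" unfolding sep(2) ..
    thus "?cc V * pderiv (?cc \<chi>) + ?cc U * ?cc \<chi> = [:?c d:]"
      by (simp add: constpp.hom_add constpp.hom_mult constp.map_poly_pderiv Polynomial.map_poly_pCons)
    have "?cc (V' * h + U' * \<chi>) = ?cc [:d':]" unfolding den(2) ..
    thus "?cc V' * ?cc h + ?cc U' * ?cc \<chi> = [:?c d':]"
      by (simp add: constpp.hom_add constpp.hom_mult Polynomial.map_poly_pCons)
    show "?c d \<noteq> 0" "?c d' \<noteq> 0" "?c f2 \<noteq> 0" "?c F0 \<noteq> 0" "?p F \<noteq> 0"
      using sep(1) den(1) f(6) F0 F by simp_all
    show "poly (?c d) \<xi> \<noteq> 0" "poly (?c d') \<xi> \<noteq> 0" "poly (?c f2 * ?c F0) \<xi> \<noteq> 0" if "poly (?p F) \<xi> = 0" for \<xi>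
      using F_roots[OF that] sep(1) den(1) f(6) F0 by simp_all
    have "?cc \<chi> dvd ?cc (g * ([:f2:] * pderiv \<chi>) - f1 * h)"
      using f(7) by (rule constpp.hom_dvd)
    also have "?cc (g * ([:f2:] * pderiv \<chi>) - f1 * h) =
        ?cc g * ([:?c f2:] * pderiv (?cc \<chi>)) - ?cc f1 * ?cc h"
      by (simp add: constpp.hom_minus constpp.hom_mult constp.map_poly_pderiv Polynomial.map_poly_pCons
          del: mult_pCons_left)
    finally show "?cc \<chi> dvd ?cc g * ([:?c f2:] * pderiv (?cc \<chi>)) - ?cc f1 * ?cc h" .
    show "poly (pderiv (?p F)) \<xi> \<noteq> 0"
      if "poly (?p F) \<xi> = 0" "poly2 (?cc \<chi>) \<xi> \<eta> = 0" "poly2 (?pp \<theta>) \<xi> \<eta> = 0" for \<xi> \<eta>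
    proof -
      \<comment> \<open>Such a point is one of the listed solutions, where \<open>F'\<close> is
        assumed nonzero.\<close>
      have "(\<xi>, \<eta>) \<in> (\<lambda>i. (xs i, ys i)) ` {1..\<mu>}"
        using sols_memI[OF that] bij_betw_imp_surj_on[OF sols] by simp
      thus ?thesis
        using squarefree by (auto simp: eval_poly1_def param.map_poly_pderiv)
    qed
  qed

  have sols_eq: "?sols =
      {(\<xi>, \<eta>). poly (?p F) \<xi> = 0 \<and> poly2 (?cc \<chi>) \<xi> \<eta> = 0 \<and> poly2 (?pp \<theta>) \<xi> \<eta> = 0}"
  proof (intro equalityI subsetI; clarsimp)
    fix \<xi> \<eta>
    assume *: "eval_poly2 const_to_alg \<chi> \<xi> \<eta> = 0" "eval_poly2 param_to_alg \<theta> \<xi> \<eta> = 0" "\<not> alg_over K \<xi>"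
    have zero: "poly2 (?cc \<chi>) \<xi> \<eta> = 0" "poly2 (?pp \<theta>) \<xi> \<eta> = 0"
      using *(1,2) by (simp_all only: eval_const eval_param)
    \<comment> \<open>A root of \<open>F0\<close> would be algebraic over \<open>K\<close>. Since
      \<open>Q \<theta> = F0 F\<close> vanishes at the common zero, \<open>F\<close> must vanish at
      \<open>\<xi>\<close>.\<close>
    have "poly (?c F0) \<xi> \<noteq> 0"
      using *(3) F0_F(1) F0 by (auto simp: alg_over_def eval_poly1_def)
    hence "poly (?p F) \<xi> = 0"
      using cp.hom_cofactor[OF idom_hom_poly_at zero(1)] zero(2) by simp
    with zero show "poly (?p F) \<xi> = 0 \<and> poly2 (?cc \<chi>) \<xi> \<eta> = 0 \<and> poly2 (?pp \<theta>) \<xi> \<eta> = 0"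
      by simp
  qed (use sols_memI in auto)

  let ?S = "Fract cp.numerator (?c f2 * ?c F0 * ?p F)"
  have "map_poly (map_poly (D k)) (?pp \<theta>) = ?pp (map_poly (map_poly (param_pderiv k)) \<theta>)"
    using D0 pd0 by (intro poly_eqI) (simp add: coeff_map_poly D_param)
  \<comment> \<open>The sum over the conjugates is the \<open>to_ac\<close> image of
    \<open>?S\<close>, which \<open>of_ac\<close> recovers.\<close>
  hence S: "S_coeff g h \<theta> n y k = ?S"
    unfolding S_coeff_def eval_const eval_param
    using cp.sum_over_conjugates by (simp add: of_ac_eqI)
  have "(\<Sum>i=1..\<mu>. eval_poly2 const_to_alg g (xs i) (ys i) / eval_poly2 const_to_alg h (xs i) (ys i) * D k (xs i)) =
     (\<Sum>(\<xi>, \<eta>) | poly (?p F) \<xi> = 0 \<and> poly2 (?cc \<chi>) \<xi> \<eta> = 0 \<and> poly2 (?pp \<theta>) \<xi> \<eta> = 0.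
       poly2 (?cc g) \<xi> \<eta> / poly2 (?cc h) \<xi> \<eta> * D k \<xi>)"
    using sum.reindex_bij_betw[OF sols[unfolded sols_eq],
        of "\<lambda>(\<xi>, \<eta>). poly2 (?cc g) \<xi> \<eta> / poly2 (?cc h) \<xi> \<eta> * D k \<xi>"]
    by (simp add: eval_const)
  \<comment> \<open>All roots of \<open>f2 F0\<close> in the larger field are complex constants, so
    the \<open>\<beta> j\<close> exhaust them.\<close>
  moreover have "bij_betw (\<lambda>j. const_to_alg (\<beta> j)) {1..\<alpha>} {b. poly (?c f2 * ?c F0) b = 0}"
  proof -
    have "bij_betw const_to_alg {b. poly (f2 * F0) b = 0} {b. poly (?c (f2 * F0)) b = 0}"
      unfolding bij_betw_def
    proof
      show "inj_on const_to_alg {b. poly (f2 * F0) b = 0}"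
        by (simp add: inj_on_def)
      show "const_to_alg ` {b. poly (f2 * F0) b = 0} = {b. poly (?c (f2 * F0)) b = 0}"
        using f(6) F0 by (auto simp del: poly_mult mult_eq_0_iff elim!: root_const_poly[rotated] simp: const.poly_map_poly)
    qed
    from bij_betw_trans[OF beta this] show ?thesis
      by (simp add: o_def constp.hom_mult)
  qed
  hence "(\<Sum>j=1..\<alpha>. ratfun_res (const_to_alg (\<beta> j)) ?S) =
      (\<Sum>b | poly (?c f2 * ?c F0) b = 0. ratfun_res b ?S)"
    by (rule sum.reindex_bij_betw)
  ultimately show "(\<Sum>i=1..\<mu>. eval_poly2 const_to_alg g (xs i) (ys i) / eval_poly2 const_to_alg h (xs i) (ys i) *
       D k (xs i)) =
    (\<Sum>j=1..\<alpha>. ratfun_res (const_to_alg (\<beta> j)) (S_coeff g h \<theta> n y k)) -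
    ratfun_Pi (S_coeff g h \<theta> n y k)"
    unfolding S using cp.sum_over_common_roots by simp
qed

end
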